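(* Let $\kappa\ge1$. For every $\varphi\in L^\infty(\Pi_\kappa)$, the kernel $T[\varphi]$ defines a bounded operator on $\ell^2(V_\kappa)$ belonging to $B_\Gamma(\ell^2(V_\kappa))$, and the map $\iota: L^\infty(\Pi_\kappa)\to B_\Gamma(\ell^2(V_\kappa))$, $\iota(\varphi)=T[\varphi]$, is an isomorphism of commutative $C^*$-algebras.
   Context: $\mathrm{T}_\kappa=(V_\kappa,E_\kappa)$ is the Cayley tree of order $\kappa$ (infinite connected acyclic graph, every vertex of degree $\kappa+1$), $d$ its graph distance. Bounded operators on $\ell^2(V_\kappa)$ are identified with their kernels $A(x,y)=\langle A\delta_y,\delta_x\rangle$. For $\alpha:\mathbb{N}_0\to\mathbb{C}$, $T_\alpha(x,y)=\alpha(d(x,y))$; $B_\Gamma(\ell^2(V_\kappa))$ is the set of bounded operators on $\ell^2(V_\kappa)$ whose kernel is $T_\alpha$ for some $\alpha$ (a commutative $C^*$-algebra). The Cartier–Dunau polynomials are defined by $P_0=1$, $P_1(t)=t$, $tP_n(t)=\frac{\kappa}{\kappa+1}P_{n+1}(t)+\frac{1}{\kappa+1}P_{n-1}(t)$ for $n\ge1$. $\Pi_\kappa$ is the probability measure $d\Pi_\kappa(t)=\frac{\kappa+1}{2\pi}\frac{\sqrt{4\kappa(\kappa+1)^{-2}-t^2}}{1-t^2}\mathbf{1}_{[-2\sqrt\kappa/(\kappa+1),\,2\sqrt\kappa/(\kappa+1)]}(t)\,dt$, with respect to which $(P_n)$ are orthogonal. For $\varphi\in L^1(\Pi_\kappa)$,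 $\widehat\varphi(n)=\int_{\mathbb{R}}P_n\varphi\,d\Pi_\kappa$ and $T[\varphi]:=T_{\widehat\varphi}$, i.e. $T[\varphi](x,y)=\widehat\varphi(d(x,y))$. *)

theory Defs
  imports "HOL-Analysis.Analysis"
begin

text \<open>Concrete model: vertices are reduced words over the alphabet {0..kappa}
 (no two consecutive equal letters), i.e. elements of the free product of kappa+1
 copies of Z/2; w is adjacent to a#w. Every vertex has degree kappa+1 and the graph
 is an infinite tree, i.e. the Cayley tree of order kappa.\<close>

definition cayley_V :: "nat \<Rightarrow> nat list set" where
  "cayley_V k = {w. (\<forall>a\<in>set w. a \<le> k) \<and> (\<forall>i. Suc i < length w \<longrightarrow> w ! i \<noteq> w ! Suc i)}"

definition cayley_adj :: "nat \<Rightarrow> nat list \<Rightarrow> nat list \<Rightarrow> bool" where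
  "cayley_adj k v w \<longleftrightarrow> v \<in> cayley_V k \<and> w \<in> cayley_V k \<and>
     ((\<exists>a. w = a # v) \<or> (\<exists>a. v = a # w))"

definition tree_dist :: "nat \<Rightarrow> nat list \<Rightarrow> nat list \<Rightarrow> nat" where
  "tree_dist k x y = (LEAST n. \<exists>p. length p = Suc n \<and> hd p = x \<and> last p = y \<and>
       (\<forall>i<n. cayley_adj k (p ! i) (p ! Suc i)))"

definition l2 :: "'a set \<Rightarrow> ('a \<Rightarrow> complex) set" where
  "l2 V = {f. (\<lambda>x. (cmod (f x))\<^sup>2) summable_on V}"

definition l2norm :: "'a set \<Rightarrow> ('a \<Rightarrow> complex) \<Rightarrow> real" where
  "l2norm V f = sqrt (\<Sum>\<^sub>\<infinity>x\<in>V. (cmod (f x))\<^sup>2)"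

definition apply_kernel :: "'a set \<Rightarrow> ('a \<Rightarrow> 'a \<Rightarrow> complex) \<Rightarrow> ('a \<Rightarrow> complex) \<Rightarrow> ('a \<Rightarrow> complex)" where
  "apply_kernel V K f = (\<lambda>x. \<Sum>\<^sub>\<infinity>y\<in>V. K x y * f y)"

definition bounded_kernel :: "'a set \<Rightarrow> ('a \<Rightarrow> 'a \<Rightarrow> complex) \<Rightarrow> bool" where
  "bounded_kernel V K \<longleftrightarrow> (\<exists>C. \<forall>f\<in>l2 V.
      (\<forall>x\<in>V. (\<lambda>y. K x y * f y) summable_on V) \<and>
      apply_kernel V K f \<in> l2 V \<and>
      l2norm V (apply_kernel V K f) \<le> C * l2norm V f)"

definition kernel_comp :: "'a set \<Rightarrow> ('a \<Rightarrow> 'a \<Rightarrow> complex) \<Rightarrow> ('a \<Rightarrow> 'a \<Rightarrow> complex) \<Rightarrow> ('a \<Rightarrow> 'a \<Rightarrow> complex)" where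
  "kernel_comp V A B = (\<lambda>x y. \<Sum>\<^sub>\<infinity>z\<in>V. A x z * B z y)"

definition kernel_adj :: "('a \<Rightarrow> 'a \<Rightarrow> complex) \<Rightarrow> ('a \<Rightarrow> 'a \<Rightarrow> complex)" where
  "kernel_adj A = (\<lambda>x y. cnj (A y x))"

definition T_alpha :: "nat \<Rightarrow> (nat \<Rightarrow> complex) \<Rightarrow> nat list \<Rightarrow> nat list \<Rightarrow> complex" where
  "T_alpha k \<alpha> x y = \<alpha> (tree_dist k x y)"

definition B_Gamma :: "nat \<Rightarrow> (nat list \<Rightarrow> nat list \<Rightarrow> complex) set" where
  "B_Gamma k = {K. bounded_kernel (cayley_V k) K \<and>
      (\<exists>\<alpha>. \<forall>x\<in>cayley_V k. \<forall>y\<in>cayley_V k. K x y = T_alpha k \<alpha> x y)}"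

fun CD :: "nat \<Rightarrow> nat \<Rightarrow> real \<Rightarrow> real" where
  "CD k 0 t = 1"
| "CD k (Suc 0) t = t"
| "CD k (Suc (Suc n)) t = ((real k + 1) * t * CD k (Suc n) t - CD k n t) / real k"

definition Pi_density :: "nat \<Rightarrow> real \<Rightarrow> real" where
  "Pi_density k t = (if \<bar>t\<bar> \<le> 2 * sqrt (real k) / (real k + 1)
      then (real k + 1) / (2 * pi) * sqrt (4 * real k / (real k + 1)\<^sup>2 - t\<^sup>2) / (1 - t\<^sup>2)
      else 0)"

definition Pi_meas :: "nat \<Rightarrow> real measure" where
  "Pi_meas k = density lborel (\<lambda>t. ennreal (Pi_density k t))"

definition Linf :: "nat \<Rightarrow> (real \<Rightarrow> complex) set" where
  "Linf k = {\<phi>. \<phi> \<in> borel_measurable (Pi_meas k) \<and> (\<exists>C. AE t in Pi_meas k. cmod (\<phi> t) \<le> C)}"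

definition fhat :: "nat \<Rightarrow> (real \<Rightarrow> complex) \<Rightarrow> nat \<Rightarrow> complex" where
  "fhat k \<phi> n = (\<integral>t. complex_of_real (CD k n t) * \<phi> t \<partial>Pi_meas k)"

definition Tphi :: "nat \<Rightarrow> (real \<Rightarrow> complex) \<Rightarrow> nat list \<Rightarrow> nat list \<Rightarrow> complex" where
  "Tphi k \<phi> = T_alpha k (fhat k \<phi>)"

end

theory Submission
  imports Defs "HOL-Library.Sublist"
begin

text \<open>
  For fixed \<open>t\<close> the functions \<open>x \<mapsto> CD k (tree_dist k x y) t\<close> are eigenfunctions of the nearest
  neighbour averaging operator with eigenvalue \<open>t\<close>. Hence multiplication by a polynomial \<open>p\<close>
  turns a finite combination of them into another one, and since the integral of \<open>CD k n\<close> against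
  \<open>Pi_meas k\<close> vanishes for \<open>n > 0\<close>, the integral of \<open>p\<^sup>2\<close> times the hermitian form with kernel
  \<open>CD k (tree_dist k x y) t\<close> is a sum of squares. By Weierstrass this form is positive for almost
  every \<open>t\<close>, which gives \<open>T[\<phi>]\<close> bounded for bounded \<open>\<phi>\<close>. Conversely a bounded kernel
  \<open>\<alpha> (tree_dist k x y)\<close> has square summable columns, so \<open>\<alpha>\<close> is the coefficient sequence of an
  integrable \<open>\<phi>\<close>; boundedness of the kernel says that the integral of \<open>p\<^sup>2 * \<phi>\<close> is at most \<open>C\<close> times
  that of \<open>p\<^sup>2\<close> in modulus, and the same Weierstrass argument shows that \<open>\<phi>\<close> is essentially
  bounded. Injectivity is the case \<open>C = 0\<close>, and multiplicativity follows from expanding one factor in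
  the \<open>CD k n\<close> and the product formula for sums over spheres.
\<close>

text \<open>Positivity of the kernels at a single \<open>t\<close> is usually obtained from
  spherical functions built on the boundary of the tree. Tested against squares of polynomials it
  becomes a computation with moments, at the price of holding only almost everywhere. The
  exceptional set depends on the finite vertex set and the coefficients, which is harmless because
  each integral concerns one fixed form. For the same reason moduli are controlled through the four
  directions 1, -1, i, -i instead of all phases, which loses a factor 2 in the constants. The result
  is a bijective star homomorphism modulo null sets; isometry follows from the general theory of
  C-star algebras. The analytic core is the integral of \<open>CD k n\<close>. After a cosine
  substitution it is a Fourier integral whose denominator has minimum (k - 1)^2. The denominator
  vanishes somewhere exactly for \<open>k = 1\<close>, where the tree is a line, and this forces a
  separate case.\<close>

section \<open>The tree\<close>

text \<open>Words grow at the head, so paths branch where common suffixes end: \<open>tail_dist\<close> is the tree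
  distance of reversed words.\<close>

fun tail_dist :: "'a list \<Rightarrow> 'a list \<Rightarrow> nat" where
  "tail_dist [] v = length v"
| "tail_dist u [] = length u"
| "tail_dist (a # u) (b # v) = (if a = b then tail_dist u v else length u + length v + 2)"

lemma tail_dist_Nil2 [simp]: "tail_dist u [] = length u"
  by (cases u) auto

lemma tail_dist_sym: "tail_dist u v = tail_dist v u"
  by (induction u v rule: tail_dist.induct) auto

lemma tail_dist_eq_0_iff: "tail_dist u v = 0 \<longleftrightarrow> u = v"
  by (induction u v rule: tail_dist.induct) auto

text \<open>For reversed words an edge appends a letter at the end. The step leads towards
  \<open>u\<close> exactly when the longer word is still a prefix of \<open>u\<close>, and away from
  \<open>u\<close> otherwise; the two lemmas are these two cases.\<close>

lemma tail_dist_snoc_prefix: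
  "prefix (v @ [a]) u \<Longrightarrow> tail_dist u v = Suc (tail_dist u (v @ [a]))"
proof (induction u v rule: tail_dist.induct)
  case (2 a u) then show ?case by (auto simp: prefix_def)
qed auto

lemma tail_dist_snoc_not_prefix:
  "\<not> prefix (v @ [a]) u \<Longrightarrow> tail_dist u (v @ [a]) = Suc (tail_dist u v)"
  by (induction u v rule: tail_dist.induct) (auto split: if_splits)

definition word_dist :: "'a list \<Rightarrow> 'a list \<Rightarrow> nat" where
  "word_dist x y = tail_dist (rev x) (rev y)"

lemma word_dist_sym: "word_dist x y = word_dist y x"
  by (simp add: word_dist_def tail_dist_sym)

lemma word_dist_eq_0_iff: "word_dist x y = 0 \<longleftrightarrow> x = y"
  by (simp add: word_dist_def tail_dist_eq_0_iff)

lemma word_dist_Cons_suffix: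
  "suffix (a # y) x \<Longrightarrow> word_dist x y = Suc (word_dist x (a # y))"
  unfolding word_dist_def by (simp add: suffix_to_prefix tail_dist_snoc_prefix)

lemma word_dist_Cons_not_suffix:
  "\<not> suffix (a # y) x \<Longrightarrow> word_dist x (a # y) = Suc (word_dist x y)"
  unfolding word_dist_def by (simp add: suffix_to_prefix tail_dist_snoc_not_prefix)

section \<open>Neighbours, paths and the graph distance\<close>

definition nbrs :: "nat \<Rightarrow> nat list \<Rightarrow> nat list set" where
  "nbrs k y = {z. cayley_adj k y z}"

lemma Nil_in_cayley_V: "[] \<in> cayley_V k"
  by (simp add: cayley_V_def)

lemma Cons_in_cayley_V:
  "a # w \<in> cayley_V k \<longleftrightarrow> a \<le> k \<and> w \<in> cayley_V k \<and> (w = [] \<or> a \<noteq> hd w)"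
proof -
  have "(\<forall>i. Suc i < length (a # w) \<longrightarrow> (a # w) ! i \<noteq> (a # w) ! Suc i) \<longleftrightarrow>
      (w = [] \<or> a \<noteq> hd w) \<and> (\<forall>i. Suc i < length w \<longrightarrow> w ! i \<noteq> w ! Suc i)" (is "?L \<longleftrightarrow> ?R")
  proof
    assume L: ?L
    then have "\<forall>i. Suc i < length w \<longrightarrow> w ! i \<noteq> w ! Suc i"
      by (metis Suc_less_eq length_Cons nth_Cons_Suc)
    moreover have "w = [] \<or> a \<noteq> hd w"
      using L[rule_format, of 0] by (auto simp: hd_conv_nth)
    ultimately show ?R by simp
  next
    assume R: ?R
    show ?L
    proof (intro allI impI)
      fix i assume "Suc i < length (a # w)"
      then show "(a # w) ! i \<noteq> (a # w) ! Suc i"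
        using R by (cases i) (auto simp: hd_conv_nth)
    qed
  qed
  then show ?thesis unfolding cayley_V_def by auto
qed

lemma suffix_in_cayley_V: "suffix y x \<Longrightarrow> x \<in> cayley_V k \<Longrightarrow> y \<in> cayley_V k"
  by (induction x) (auto simp: suffix_Cons Cons_in_cayley_V)

lemma cayley_adj_sym: "cayley_adj k y z \<longleftrightarrow> cayley_adj k z y"
  by (auto simp: cayley_adj_def)

lemma in_nbrs_sym: "z \<in> nbrs k y \<longleftrightarrow> y \<in> nbrs k z"
  by (auto simp: nbrs_def cayley_adj_sym)

lemma nbrs_subset: "nbrs k y \<subseteq> cayley_V k"
  by (auto simp: nbrs_def cayley_adj_def)

lemma nbrs_Nil: "nbrs k [] = (\<lambda>a. [a]) ` {..k}"
  by (auto simp: nbrs_def cayley_adj_def Nil_in_cayley_V Cons_in_cayley_V)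

lemma nbrs_Cons:
  assumes "b # w \<in> cayley_V k"
  shows "nbrs k (b # w) = insert w ((\<lambda>a. a # b # w) ` ({..k} - {b}))"
  using assms by (auto simp: nbrs_def cayley_adj_def Cons_in_cayley_V)

lemma finite_nbrs [simp]: "finite (nbrs k y)"
proof (cases "y \<in> cayley_V k")
  case True
  then show ?thesis by (cases y) (auto simp: nbrs_Nil nbrs_Cons)
next
  case False
  then have "nbrs k y = {}" by (auto simp: nbrs_def cayley_adj_def)
  then show ?thesis by simp
qed

lemma card_nbrs:
  assumes "y \<in> cayley_V k" shows "card (nbrs k y) = Suc k"
proof (cases y)
  case Nil
  then show ?thesis by (simp add: nbrs_Nil card_image inj_on_def)
next
  case (Cons b w)
  have "w \<notin> (\<lambda>a. a # b # w) ` ({..k} - {b})"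
  proof
    assume "w \<in> (\<lambda>a. a # b # w) ` ({..k} - {b})"
    then obtain a where "w = a # b # w" by blast
    then have "length w = length (a # b # w)" by simp
    then show False by simp
  qed
  then show ?thesis using Cons assms
    by (simp add: nbrs_Cons card_image inj_on_def Cons_in_cayley_V)
qed

lemma word_dist_nbr:
  assumes "z \<in> nbrs k y"
  shows "word_dist x z = Suc (word_dist x y) \<or> word_dist x y = Suc (word_dist x z)"
proof -
  consider a where "z = a # y" | a where "y = a # z"
    using assms by (auto simp: nbrs_def cayley_adj_def)
  then show ?thesis
    by cases (metis word_dist_Cons_suffix word_dist_Cons_not_suffix)+
qed

text \<open>This is the absence of cycles in the form used for counting. If \<open>y\<close> is a
  suffix of \<open>x\<close>, the closer neighbour prolongs \<open>y\<close> by one more letter of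
  \<open>x\<close>; otherwise it is the tail of \<open>y\<close>.\<close>

lemma closer_nbr_exists:
  assumes x: "x \<in> cayley_V k" and y: "y \<in> cayley_V k" and "x \<noteq> y"
  shows "\<exists>z\<in>nbrs k y. word_dist x y = Suc (word_dist x z) \<and>
    (\<forall>z'\<in>nbrs k y. z' \<noteq> z \<longrightarrow> word_dist x z' = Suc (word_dist x y))"
proof (cases "suffix y x")
  case True
  with \<open>x \<noteq> y\<close> obtain u where u: "x = u @ y" "u \<noteq> []"
    by (auto elim: suffixE)
  \<comment> \<open>Words grow at the head, so in \<open>x = u @ y\<close> the letter next to
    \<open>y\<close> is the last one of \<open>u\<close>.\<close>
  define a where "a = last u"
  have s: "suffix (a # y) x"
    using u unfolding a_def suffix_def
    by (metis append_Cons append_Nil append_assoc append_butlast_last_id)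
  have "a # y \<in> nbrs k y"
    using y s x suffix_in_cayley_V by (auto simp: nbrs_def cayley_adj_def)
  moreover have "word_dist x z' = Suc (word_dist x y)" if z': "z' \<in> nbrs k y" "z' \<noteq> a # y" for z'
  proof -
    consider b where "z' = b # y" | b where "y = b # z'"
      using z' by (auto simp: nbrs_def cayley_adj_def)
    then show ?thesis
    proof cases
      case (1 b)
      have "\<not> suffix (b # y) x"
      proof
        assume "suffix (b # y) x"
        then have "suffix (b # y) (a # y)"
          by (metis s suffix_length_suffix length_Cons order_refl)
        then show False using 1 z' by (auto simp: suffix_Cons dest: suffix_length_le)
      qed
      then show ?thesis using 1 word_dist_Cons_not_suffix by metis
    next
      case (2 b)
      then show ?thesis using True word_dist_Cons_suffix by metis
    qed
  qed
  ultimately show ?thesis using word_dist_Cons_suffix[OF s] by blast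
next
  case False
  then obtain b w where yb: "y = b # w" by (cases y) auto
  have "w \<in> nbrs k y" using y yb by (simp add: nbrs_Cons)
  moreover have "word_dist x y = Suc (word_dist x w)"
    using False yb word_dist_Cons_not_suffix by metis
  moreover have "word_dist x z' = Suc (word_dist x y)" if z': "z' \<in> nbrs k y" "z' \<noteq> w" for z'
  proof -
    obtain a where "z' = a # y" using z' y yb by (auto simp: nbrs_Cons)
    moreover have "\<not> suffix (a # y) x" using False suffix_ConsD by metis
    ultimately show ?thesis using word_dist_Cons_not_suffix by metis
  qed
  ultimately show ?thesis by blast
qed

text \<open>An edge changes \<open>word_dist\<close> by one, so this is the lower bound for the
  \<open>LEAST\<close> in \<open>tree_dist\<close>. It is attained by
  \<open>path_of_word_dist\<close>, which walks back from \<open>y\<close> through closer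
  neighbours.\<close>

lemma word_dist_le_path_length:
  assumes "length p = Suc n" "\<forall>i<n. cayley_adj k (p ! i) (p ! Suc i)"
  shows "word_dist (hd p) (last p) \<le> n"
proof -
  have "m \<le> n \<Longrightarrow> word_dist (hd p) (p ! m) \<le> m" for m
  proof (induction m)
    case 0
    then show ?case using assms by (cases p) (auto simp: word_dist_eq_0_iff)
  next
    case (Suc m)
    then have "p ! Suc m \<in> nbrs k (p ! m)" using assms by (simp add: nbrs_def)
    then show ?case using word_dist_nbr[of "p ! Suc m" k "p ! m" "hd p"] Suc by auto
  qed
  moreover have "last p = p ! n" using assms(1) by (cases p) (auto simp: last_conv_nth)
  ultimately show ?thesis by simp
qed

lemma path_of_word_dist:
  assumes "x \<in> cayley_V k" "y \<in> cayley_V k"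
  shows "\<exists>p. length p = Suc (word_dist x y) \<and> hd p = x \<and> last p = y \<and>
      (\<forall>i<word_dist x y. cayley_adj k (p ! i) (p ! Suc i))"
  using assms
proof (induction "word_dist x y" arbitrary: y)
  case 0
  then have "x = y" by (metis word_dist_eq_0_iff)
  then show ?case using 0 by (intro exI[of _ "[x]"]) simp
next
  case (Suc n)
  then have "x \<noteq> y" by (metis word_dist_eq_0_iff nat.distinct(1))
  then obtain z where z: "z \<in> nbrs k y" "word_dist x y = Suc (word_dist x z)"
    using closer_nbr_exists Suc by meson
  then obtain p where p: "length p = Suc (word_dist x z)" "hd p = x" "last p = z"
     "\<forall>i<word_dist x z. cayley_adj k (p ! i) (p ! Suc i)"
    using Suc nbrs_subset by (metis old.nat.inject subsetD)
  have zz: "p ! word_dist x z = z" using p(1,3) by (metis diff_Suc_1 last_conv_nth list.size(3) nat.distinct(1))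
  show ?case
  proof (intro exI[of _ "p @ [y]"] conjI allI impI)
    show "hd (p @ [y]) = x" using p by (cases p) auto
    fix i assume "i < word_dist x y"
    then consider "i < word_dist x z" | "i = word_dist x z" using z by linarith
    then show "cayley_adj k ((p @ [y]) ! i) ((p @ [y]) ! Suc i)"
    proof cases
      case 1 then show ?thesis using p by (simp add: nth_append)
    next
      case 2 then show ?thesis using p zz z by (simp add: nth_append nbrs_def cayley_adj_sym)
    qed
  qed (use p z in auto)
qed

lemma tree_dist_eq_word_dist:
  assumes "x \<in> cayley_V k" "y \<in> cayley_V k"
  shows "tree_dist k x y = word_dist x y"
  unfolding tree_dist_def
proof (rule Least_equality)
  fix n assume "\<exists>p. length p = Suc n \<and> hd p = x \<and> last p = y \<and>
       (\<forall>i<n. cayley_adj k (p ! i) (p ! Suc i))"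
  then show "word_dist x y \<le> n" using word_dist_le_path_length by blast
qed (rule path_of_word_dist[OF assms])

lemma tree_dist_sym:
  "x \<in> cayley_V k \<Longrightarrow> y \<in> cayley_V k \<Longrightarrow> tree_dist k x y = tree_dist k y x"
  by (simp add: tree_dist_eq_word_dist word_dist_sym)

lemma tree_dist_eq_0_iff:
  "x \<in> cayley_V k \<Longrightarrow> y \<in> cayley_V k \<Longrightarrow> tree_dist k x y = 0 \<longleftrightarrow> x = y"
  by (simp add: tree_dist_eq_word_dist word_dist_eq_0_iff)

lemma tree_dist_nbr:
  assumes "x \<in> cayley_V k" "y \<in> cayley_V k" "z \<in> nbrs k y"
  shows "tree_dist k x z = Suc (tree_dist k x y) \<or> tree_dist k x y = Suc (tree_dist k x z)"
proof -
  have "z \<in> cayley_V k" using assms(3) nbrs_subset by blast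
  then show ?thesis
    using assms(1,2) word_dist_nbr[OF assms(3), of x] by (simp add: tree_dist_eq_word_dist)
qed

lemma closer_nbrE:
  assumes "x \<in> cayley_V k" "y \<in> cayley_V k" "x \<noteq> y"
  obtains z where "z \<in> nbrs k y" "tree_dist k x y = Suc (tree_dist k x z)"
    "\<And>z'. z' \<in> nbrs k y \<Longrightarrow> z' \<noteq> z \<Longrightarrow> tree_dist k x z' = Suc (tree_dist k x y)"
proof -
  obtain z where z: "z \<in> nbrs k y" "word_dist x y = Suc (word_dist x z)"
    "\<forall>z'\<in>nbrs k y. z' \<noteq> z \<longrightarrow> word_dist x z' = Suc (word_dist x y)"
    using closer_nbr_exists[OF assms] by blast
  show ?thesis
    using z assms nbrs_subset[of k y]
    by (intro that[of z]) (auto simp: tree_dist_eq_word_dist subset_iff)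
qed

text \<open>Away from \<open>x\<close> one neighbour is closer and the remaining \<open>k\<close>
  are farther; at \<open>x\<close> all \<open>k + 1\<close> are at distance 1. The eigenvalue
  equation and the sphere counts both come from this formula.\<close>

lemma sum_nbrs_radial:
  fixes F :: "nat \<Rightarrow> 'a::comm_semiring_1"
  assumes x: "x \<in> cayley_V k" and y: "y \<in> cayley_V k"
  shows "(\<Sum>z\<in>nbrs k y. F (tree_dist k x z)) =
    (if x = y then of_nat (Suc k) * F 1
     else F (tree_dist k x y - 1) + of_nat k * F (Suc (tree_dist k x y)))"
proof (cases "x = y")
  case True
  have "tree_dist k x z = 1" if "z \<in> nbrs k y" for z
    using tree_dist_nbr[OF x y that] True x tree_dist_eq_0_iff[of x k x] by auto
  then have "(\<Sum>z\<in>nbrs k y. F (tree_dist k x z)) = (\<Sum>z\<in>nbrs k y. F 1)" by simp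
  then show ?thesis using True card_nbrs[OF y] by simp
next
  case False
  obtain z where z: "z \<in> nbrs k y" "tree_dist k x y = Suc (tree_dist k x z)"
    "\<And>z'. z' \<in> nbrs k y \<Longrightarrow> z' \<noteq> z \<Longrightarrow> tree_dist k x z' = Suc (tree_dist k x y)"
    using closer_nbrE[OF x y False] by blast
  have "(\<Sum>z\<in>nbrs k y. F (tree_dist k x z)) =
      F (tree_dist k x z) + (\<Sum>z'\<in>nbrs k y - {z}. F (tree_dist k x z'))"
    using z by (simp add: sum.remove)
  also have "(\<Sum>z'\<in>nbrs k y - {z}. F (tree_dist k x z')) =
      (\<Sum>z'\<in>nbrs k y - {z}. F (Suc (tree_dist k x y)))"
    using z by (intro sum.cong) auto
  also have "\<dots> = of_nat k * F (Suc (tree_dist k x y))"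
    using z card_nbrs[OF y] by simp
  finally show ?thesis using False z by simp
qed

lemma CD_rec: "k \<ge> 1 \<Longrightarrow> real k * CD k (Suc (Suc n)) t = (real k + 1) * t * CD k (Suc n) t - CD k n t"
  by simp

text \<open>The recurrence of \<open>CD\<close> is exactly \<open>sum_nbrs_radial\<close> at
  positive distance, and \<open>CD k 1 t = t\<close> is its case at distance 0.\<close>

lemma sum_nbrs_CD:
  assumes "k \<ge> 1" and x: "x \<in> cayley_V k" and y: "y \<in> cayley_V k"
  shows "(\<Sum>z\<in>nbrs k x. CD k (tree_dist k z y) t) = (real k + 1) * t * CD k (tree_dist k x y) t"
proof -
  have "(\<Sum>z\<in>nbrs k x. CD k (tree_dist k z y) t) = (\<Sum>z\<in>nbrs k x. CD k (tree_dist k y z) t)"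
  proof (intro sum.cong refl)
    fix z assume "z \<in> nbrs k x"
    then have "z \<in> cayley_V k" using nbrs_subset by blast
    then show "CD k (tree_dist k z y) t = CD k (tree_dist k y z) t"
      using tree_dist_sym[OF _ y] by simp
  qed
  also have "\<dots> = (real k + 1) * t * CD k (tree_dist k y x) t"
  proof (cases "y = x")
    case True
    then show ?thesis using x sum_nbrs_radial[OF y x, of "\<lambda>n. CD k n t"]
      by (simp add: tree_dist_eq_0_iff[THEN iffD2])
  next
    case False
    then obtain n where n: "tree_dist k y x = Suc n"
      using tree_dist_eq_0_iff[OF y x] by (cases "tree_dist k y x") auto
    show ?thesis using False n CD_rec[OF assms(1)] sum_nbrs_radial[OF y x, of "\<lambda>n. CD k n t"]
      by (simp del: CD.simps(3))
  qed
  finally show ?thesis using tree_dist_sym[OF x y] by simp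
qed

section \<open>Sums over spheres and the product formula\<close>

definition sphere_at :: "nat \<Rightarrow> nat list \<Rightarrow> nat \<Rightarrow> nat list set" where
  "sphere_at k x n = {z \<in> cayley_V k. tree_dist k x z = n}"

text \<open>The common size of all spheres of radius \<open>n\<close>. That this closed formula is
  correct is shown only in \<open>card_sphere_at\<close>, as a by-product of the product
  formula.\<close>

definition sphere_card :: "nat \<Rightarrow> nat \<Rightarrow> real" where
  "sphere_card k n = (if n = 0 then 1 else (real k + 1) * real k ^ (n - 1))"

lemma sphere_at_0: "x \<in> cayley_V k \<Longrightarrow> sphere_at k x 0 = {x}"
  by (auto simp: sphere_at_def tree_dist_eq_0_iff)

lemma sphere_at_Suc_subset:
  assumes x: "x \<in> cayley_V k"
  shows "sphere_at k x (Suc n) \<subseteq> (\<Union>z\<in>sphere_at k x n. nbrs k z)"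
proof
  fix y assume "y \<in> sphere_at k x (Suc n)"
  then have y: "y \<in> cayley_V k" "tree_dist k x y = Suc n" by (auto simp: sphere_at_def)
  then have "x \<noteq> y" using x tree_dist_eq_0_iff by force
  obtain z where "z \<in> nbrs k y" "tree_dist k x y = Suc (tree_dist k x z)"
    using closer_nbrE[OF x y(1) \<open>x \<noteq> y\<close>] by blast
  then show "y \<in> (\<Union>z\<in>sphere_at k x n. nbrs k z)"
    using y in_nbrs_sym nbrs_subset by (fastforce simp: sphere_at_def)
qed

lemma finite_sphere_at: "x \<in> cayley_V k \<Longrightarrow> finite (sphere_at k x n)"
proof (induction n)
  case (Suc n)
  then show ?case using sphere_at_Suc_subset finite_subset finite_UN finite_nbrs by metis
qed (simp add: sphere_at_0)

text \<open>Double counting of edges: a vertex of the outer sphere is reached from one vertex of the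
  middle sphere, a vertex of the inner sphere from \<open>k\<close> of them, and the centre itself
  from \<open>k + 1\<close>.\<close>

lemma sum_sphere_sum_nbrs:
  fixes F :: "nat list \<Rightarrow> real"
  assumes k: "k \<ge> 1" and x: "x \<in> cayley_V k"
  shows "(\<Sum>z\<in>sphere_at k x (Suc n). \<Sum>w\<in>nbrs k z. F w) =
    (\<Sum>w\<in>sphere_at k x (Suc (Suc n)). F w) +
    (if n = 0 then real k + 1 else real k) * (\<Sum>w\<in>sphere_at k x n. F w)"
proof -
  let ?S = "sphere_at k x" and ?U = "\<Union>z\<in>sphere_at k x (Suc n). nbrs k z"
  have fin: "finite ?U" "finite (?S m)" for m using finite_sphere_at[OF x] by auto
  \<comment> \<open>The number of neighbours of \<open>w\<close> on the middle sphere, obtained from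
    \<open>sum_nbrs_radial\<close> with an indicator as radial function.\<close>
  have cnt: "(\<Sum>z\<in>nbrs k w. if tree_dist k x z = Suc n then 1 else 0::real) =
     (if w \<in> ?S (Suc (Suc n)) then 1 else 0) +
     (if w \<in> ?S n then (if n = 0 then real k + 1 else real k) else 0)" if w: "w \<in> cayley_V k" for w
    using sum_nbrs_radial[OF x w, of "\<lambda>m. if m = Suc n then 1 else 0::real"] x w
      tree_dist_eq_0_iff[OF x w]
    by (auto simp: sphere_at_def)
  have UV: "?U \<subseteq> cayley_V k" using nbrs_subset by blast
  have S2: "?S (Suc (Suc n)) \<subseteq> ?U" using sphere_at_Suc_subset[OF x] .
  \<comment> \<open>The inner sphere lies in the union because the count just found is nonzero
    there; \<open>k \<ge> 1\<close> enters here.\<close>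
  have S0: "w \<in> ?U" if w: "w \<in> ?S n" for w
  proof -
    have wV: "w \<in> cayley_V k" using w by (simp add: sphere_at_def)
    have "\<exists>z\<in>nbrs k w. tree_dist k x z = Suc n"
    proof (rule ccontr)
      assume *: "\<not> ?thesis"
      then have "(\<Sum>z\<in>nbrs k w. if tree_dist k x z = Suc n then 1 else 0::real) = 0"
        by (intro sum.neutral) auto
      then show False using cnt[OF wV] w k by (auto simp: sphere_at_def split: if_splits)
    qed
    then show ?thesis using in_nbrs_sym nbrs_subset by (fastforce simp: sphere_at_def)
  qed
  have "(\<Sum>z\<in>?S (Suc n). \<Sum>w\<in>nbrs k z. F w) = (\<Sum>z\<in>?S (Suc n). \<Sum>w\<in>{w\<in>?U. w \<in> nbrs k z}. F w)"
    by (intro sum.cong) auto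
  also have "\<dots> = (\<Sum>w\<in>?U. \<Sum>z\<in>{z\<in>?S (Suc n). w \<in> nbrs k z}. F w)"
    using fin(1) fin(2)[of "Suc n"] by (intro sum.swap_restrict)
  also have "\<dots> = (\<Sum>w\<in>?U. F w * (\<Sum>z\<in>nbrs k w. if tree_dist k x z = Suc n then 1 else 0))"
  proof (intro sum.cong refl)
    fix w assume "w \<in> ?U"
    have "{z\<in>?S (Suc n). w \<in> nbrs k z} = {z \<in> nbrs k w. tree_dist k x z = Suc n}"
      using nbrs_subset in_nbrs_sym by (auto simp: sphere_at_def subset_iff)
    then show "(\<Sum>z\<in>{z\<in>?S (Suc n). w \<in> nbrs k z}. F w) =
       F w * (\<Sum>z\<in>nbrs k w. if tree_dist k x z = Suc n then 1 else 0)"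
      by (simp add: sum.If_cases Int_def)
  qed
  also have "\<dots> = (\<Sum>w\<in>?U. (if w \<in> ?S (Suc (Suc n)) then F w else 0) +
     (if w \<in> ?S n then (if n = 0 then real k + 1 else real k) * F w else 0))"
    using UV by (intro sum.cong refl) (auto simp: cnt subset_iff algebra_simps)
  also have "\<dots> = (\<Sum>w\<in>?U \<inter> ?S (Suc (Suc n)). F w) +
     (\<Sum>w\<in>?U \<inter> ?S n. (if n = 0 then real k + 1 else real k) * F w)"
    using fin by (simp add: sum.distrib sum.inter_restrict[symmetric])
  also have "?U \<inter> ?S (Suc (Suc n)) = ?S (Suc (Suc n))" using S2 by blast
  also have "?U \<inter> ?S n = ?S n" using S0 by blast
  finally show ?thesis by (simp add: sum_distrib_left)
qed

lemma sphere_at_1: "x \<in> cayley_V k \<Longrightarrow> sphere_at k x (Suc 0) = nbrs k x"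
proof
  assume x: "x \<in> cayley_V k"
  show "sphere_at k x (Suc 0) \<subseteq> nbrs k x"
    using sphere_at_Suc_subset[OF x, of 0] sphere_at_0[OF x] by simp
  show "nbrs k x \<subseteq> sphere_at k x (Suc 0)"
  proof
    fix z assume z: "z \<in> nbrs k x"
    then have "z \<in> cayley_V k" using nbrs_subset by blast
    then show "z \<in> sphere_at k x (Suc 0)"
      using tree_dist_nbr[OF x x z] tree_dist_eq_0_iff[OF x x] by (simp add: sphere_at_def)
  qed
qed

lemma sphere_card_Suc_Suc: "sphere_card k (Suc (Suc n)) = real k * sphere_card k (Suc n)"
  by (simp add: sphere_card_def)

lemma sphere_card_Suc:
  "sphere_card k (Suc n) = (if n = 0 then real k + 1 else real k) * sphere_card k n"
  by (cases n) (simp_all add: sphere_card_def)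

text \<open>Summing over a sphere is a polynomial in the averaging operator, so it acts on the
  eigenfunction by a scalar. The induction identifies this scalar, since
  \<open>sum_sphere_sum_nbrs\<close> is the recurrence of \<open>CD\<close> weighted by
  \<open>sphere_card\<close>.\<close>

lemma sum_sphere_CD:
  assumes k: "k \<ge> 1" and x: "x \<in> cayley_V k" and y: "y \<in> cayley_V k"
  shows "(\<Sum>z\<in>sphere_at k x n. CD k (tree_dist k z y) t) =
    sphere_card k n * CD k n t * CD k (tree_dist k x y) t"
proof (induction n rule: induct_nat_012)
  case 0
  then show ?case by (simp add: sphere_at_0[OF x] sphere_card_def)
next
  case 1
  then show ?case by (simp add: sphere_at_1[OF x] sphere_card_def sum_nbrs_CD[OF k x y])
next
  case (ge2 n)
  let ?F = "\<lambda>z. CD k (tree_dist k z y) t" and ?D = "CD k (tree_dist k x y) t"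
  have "(\<Sum>w\<in>sphere_at k x (Suc (Suc n)). ?F w) =
      (\<Sum>z\<in>sphere_at k x (Suc n). \<Sum>w\<in>nbrs k z. ?F w) -
      (if n = 0 then real k + 1 else real k) * (\<Sum>w\<in>sphere_at k x n. ?F w)"
    using sum_sphere_sum_nbrs[OF k x, where n = n and F = ?F] by simp
  also have "(\<Sum>z\<in>sphere_at k x (Suc n). \<Sum>w\<in>nbrs k z. ?F w) =
      (real k + 1) * t * (\<Sum>z\<in>sphere_at k x (Suc n). ?F z)"
    unfolding sum_distrib_left
    by (intro sum.cong refl sum_nbrs_CD[OF k _ y]) (simp add: sphere_at_def)
  also have "\<dots> - (if n = 0 then real k + 1 else real k) * (\<Sum>w\<in>sphere_at k x n. ?F w) =
      (real k + 1) * t * (sphere_card k (Suc n) * CD k (Suc n) t * ?D) -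
      (if n = 0 then real k + 1 else real k) * (sphere_card k n * CD k n t * ?D)"
    by (simp only: ge2)
  \<comment> \<open>The case distinction at \<open>n = 0\<close> is absorbed by
    \<open>sphere_card_Suc\<close>, which turns both coefficients into
    \<open>sphere_card k (Suc n)\<close>.\<close>
  also have "\<dots> = sphere_card k (Suc n) * ((real k + 1) * t * CD k (Suc n) t - CD k n t) * ?D"
    by (simp only: sphere_card_Suc[of k n]) (simp add: algebra_simps)
  also have "\<dots> = sphere_card k (Suc (Suc n)) * CD k (Suc (Suc n)) t * ?D"
    by (simp only: sphere_card_Suc_Suc CD_rec[OF k, symmetric]) (simp add: algebra_simps del: CD.simps)
  finally show ?case .
qed

lemma CD_at_1: "k \<ge> 1 \<Longrightarrow> CD k n 1 = 1"
  by (induction n rule: induct_nat_012) simp_all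

text \<open>At \<open>t = 1\<close> every \<open>CD k n\<close> takes the value 1, and the product
  formula becomes a count.\<close>

lemma card_sphere_at:
  assumes "k \<ge> 1" "x \<in> cayley_V k"
  shows "real (card (sphere_at k x n)) = sphere_card k n"
  using sum_sphere_CD[OF assms assms(2), where n = n and t = 1] assms(1) by (simp add: CD_at_1)

section \<open>Moments of the spectral measure\<close>

definition Pi_radius :: "nat \<Rightarrow> real" where
  "Pi_radius k = 2 * sqrt (real k) / (real k + 1)"

lemma Pi_radius_nonneg: "Pi_radius k \<ge> 0"
  by (simp add: Pi_radius_def)

lemma Pi_radius_sq: "(Pi_radius k)\<^sup>2 = 4 * real k / (real k + 1)\<^sup>2"
  by (simp add: Pi_radius_def power_divide power_mult_distrib)

text \<open>This is the arithmetic-geometric mean inequality for 1 and \<open>k\<close>. Equality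
  holds for \<open>k = 1\<close>, where the factor 1 - t^2 in the density vanishes at both ends of
  the support.\<close>

lemma Pi_radius_le_1: "Pi_radius k \<le> 1"
proof -
  have "0 \<le> (sqrt (real k) - 1)\<^sup>2" by simp
  then have "2 * sqrt (real k) \<le> real k + 1" by (simp add: power2_diff)
  then show ?thesis by (simp add: Pi_radius_def)
qed

lemma Pi_density_eq:
  "Pi_density k t = (if \<bar>t\<bar> \<le> Pi_radius k
      then (real k + 1) / (2 * pi) * sqrt ((Pi_radius k)\<^sup>2 - t\<^sup>2) / (1 - t\<^sup>2) else 0)"
  unfolding Pi_density_def Pi_radius_sq unfolding Pi_radius_def by simp

lemma Pi_density_measurable [measurable]: "Pi_density k \<in> borel_measurable borel"
  unfolding Pi_density_def by measurable

lemma Pi_density_nonneg: "Pi_density k t \<ge> 0"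
proof (cases "\<bar>t\<bar> \<le> Pi_radius k")
  case True
  then have "\<bar>t\<bar> \<le> 1" using Pi_radius_le_1[of k] by linarith
  then have "t\<^sup>2 \<le> 1" by (simp add: abs_square_le_1)
  moreover have "t\<^sup>2 \<le> (Pi_radius k)\<^sup>2"
    using True Pi_radius_nonneg[of k] by (simp add: abs_le_square_iff[symmetric])
  ultimately show ?thesis unfolding Pi_density_eq by (auto intro!: divide_nonneg_nonneg mult_nonneg_nonneg)
qed (simp add: Pi_density_eq)

lemma sets_Pi_meas [simp, measurable_cong]: "sets (Pi_meas k) = sets borel"
  by (simp add: Pi_meas_def)

lemma space_Pi_meas [simp]: "space (Pi_meas k) = UNIV"
  by (simp add: Pi_meas_def)

lemma AE_Pi_radius: "AE t in Pi_meas k. \<bar>t\<bar> \<le> Pi_radius k"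
  unfolding Pi_meas_def by (subst AE_density) (auto simp: Pi_density_eq)

lemma AE_Pi_abs_le_1: "AE t in Pi_meas k. \<bar>t\<bar> \<le> 1"
  using AE_Pi_radius by eventually_elim (use Pi_radius_le_1[of k] in linarith)

text \<open>The density of \<open>Pi_meas k\<close> in the coordinate \<open>t = Pi_radius k * cos \<theta>\<close>, \<open>\<theta> \<in> [-pi, 0]\<close>
  (an interval on which the cosine increases).\<close>

definition Pi_angle_density :: "nat \<Rightarrow> real \<Rightarrow> real" where
  "Pi_angle_density k \<theta> = Pi_density k (Pi_radius k * cos \<theta>) * (- Pi_radius k * sin \<theta>)"

lemma Pi_angle_density_eq:
  assumes "\<theta> \<in> {-pi..0}"
  shows "Pi_angle_density k \<theta> = (real k + 1) / (2 * pi) *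
    (((Pi_radius k)\<^sup>2 * (sin \<theta>)\<^sup>2) / (1 - (Pi_radius k)\<^sup>2 * (cos \<theta>)\<^sup>2))"
proof -
  have s: "sin \<theta> \<le> 0" using sin_ge_zero[of "- \<theta>"] assms by simp
  have le: "\<bar>Pi_radius k * cos \<theta>\<bar> \<le> Pi_radius k"
    using Pi_radius_nonneg[of k] abs_cos_le_one[of \<theta>] by (simp add: abs_mult mult_left_le)
  have "(Pi_radius k)\<^sup>2 - (Pi_radius k * cos \<theta>)\<^sup>2 = (Pi_radius k * sin \<theta>)\<^sup>2"
    by (simp add: power_mult_distrib sin_squared_eq algebra_simps)
  then have "sqrt ((Pi_radius k)\<^sup>2 - (Pi_radius k * cos \<theta>)\<^sup>2) = - (Pi_radius k * sin \<theta>)"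
    using s Pi_radius_nonneg[of k] by (simp add: abs_mult)
  then show ?thesis using le
    by (simp add: Pi_angle_density_def Pi_density_eq) (simp add: power2_eq_square mult_ac)
qed

text \<open>The Jacobian of the substitution supplies a second factor sin, and the resulting
  quotient is at most 1 because the squared radius is at most 1.\<close>

lemma Pi_angle_density_bounds:
  assumes "\<theta> \<in> {-pi..0}"
  shows "0 \<le> Pi_angle_density k \<theta>" "Pi_angle_density k \<theta> \<le> (real k + 1) / (2 * pi)"
proof -
  let ?c = "(Pi_radius k)\<^sup>2"
  have c: "0 \<le> ?c" "?c \<le> 1"
    using Pi_radius_le_1[of k] Pi_radius_nonneg[of k] by (simp_all add: power_le_one)
  have "?c * (sin \<theta>)\<^sup>2 \<le> 1 - ?c * (cos \<theta>)\<^sup>2"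
    using c by (simp add: sin_squared_eq algebra_simps)
  \<comment> \<open>For \<open>k = 1\<close> the denominator is 0 at both ends of the interval;
    division by zero gives 0, so the bounds persist there.\<close>
  moreover have quot: "0 \<le> a / b" "a / b \<le> 1" if "a \<le> b" "0 \<le> a" for a b :: real
    using that by (auto simp: divide_le_eq_1)
  ultimately have "0 \<le> ?c * (sin \<theta>)\<^sup>2 / (1 - ?c * (cos \<theta>)\<^sup>2)"
      "?c * (sin \<theta>)\<^sup>2 / (1 - ?c * (cos \<theta>)\<^sup>2) \<le> 1"
    using c by (auto intro!: quot simp del: zero_le_divide_iff)
  then show "0 \<le> Pi_angle_density k \<theta>" "Pi_angle_density k \<theta> \<le> (real k + 1) / (2 * pi)"
    unfolding Pi_angle_density_eq[OF assms]
    by (simp_all add: mult_left_le del: times_divide_eq_right times_divide_eq_left)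
qed

lemma cos_subst:
  shows "\<And>\<theta>. ((\<lambda>\<theta>. Pi_radius k * cos \<theta>) has_real_derivative - Pi_radius k * sin \<theta>) (at \<theta>)"
    and "continuous_on {-pi..0} (\<lambda>\<theta>. - Pi_radius k * sin \<theta>)"
    and "\<And>\<theta>. \<theta> \<in> {-pi..0} \<Longrightarrow> - Pi_radius k * sin \<theta> \<ge> 0"
proof -
  fix \<theta> :: real assume "\<theta> \<in> {-pi..0}"
  then have "sin \<theta> \<le> 0" using sin_ge_zero[of "- \<theta>"] by simp
  then show "- Pi_radius k * sin \<theta> \<ge> 0" using Pi_radius_nonneg[of k]
    by (simp add: mult_nonneg_nonpos)
qed (auto intro!: derivative_eq_intros continuous_intros)

text \<open>For \<open>k = 1\<close> the density is 1 / (pi sqrt (1 - t^2)), unbounded near the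
  ends. Finiteness is therefore read off in the angle coordinate, where the density is
  bounded.\<close>

lemma integrable_Pi_density: "integrable lborel (Pi_density k)"
proof (rule integrableI_nonneg)
  have "(\<integral>\<^sup>+ t. ennreal (Pi_density k t) \<partial>lborel) =
      (\<integral>\<^sup>+ t. ennreal (Pi_density k t * indicator {Pi_radius k * cos (-pi)..Pi_radius k * cos 0} t) \<partial>lborel)"
    by (intro nn_integral_cong) (auto simp: Pi_density_eq indicator_def)
  also have "\<dots> = (\<integral>\<^sup>+ \<theta>. ennreal (Pi_density k (Pi_radius k * cos \<theta>) * (- Pi_radius k * sin \<theta>) *
       indicator {-pi..0} \<theta>) \<partial>lborel)"
    using cos_subst by (intro nn_integral_substitution)
      (auto simp: set_borel_measurable_def)
  also have "\<dots> \<le> (\<integral>\<^sup>+ \<theta>. ennreal ((real k + 1) / (2 * pi)) * indicator {-pi..0} \<theta> \<partial>lborel)"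
    using Pi_angle_density_bounds(2)[of _ k] unfolding Pi_angle_density_def
    by (intro nn_integral_mono) (auto simp: indicator_def intro!: ennreal_leI)
  also have "\<dots> < \<infinity>"
    by (subst nn_integral_cmult_indicator) (auto simp: ennreal_mult_less_top)
  finally show "(\<integral>\<^sup>+ t. ennreal (Pi_density k t) \<partial>lborel) < \<infinity>" .
qed (auto simp: Pi_density_nonneg)

lemma finite_measure_Pi: "finite_measure (Pi_meas k)"
proof
  show "emeasure (Pi_meas k) (space (Pi_meas k)) \<noteq> \<infinity>"
    using integrable_Pi_density[of k]
    by (simp add: Pi_meas_def emeasure_density integrable_iff_bounded Pi_density_nonneg)
qed

lemma Pi_integrable_continuous:
  fixes f :: "real \<Rightarrow> 'b::{banach,second_countable_topology,real_normed_algebra}"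
  assumes "continuous_on UNIV f"
  shows "integrable (Pi_meas k) f"
proof -
  interpret finite_measure "Pi_meas k" by (rule finite_measure_Pi)
  have "compact (f ` {-1..1})"
    using assms by (intro compact_continuous_image) (auto intro: continuous_on_subset)
  then obtain B where B: "\<And>t. t \<in> {-1..1} \<Longrightarrow> norm (f t) \<le> B"
    by (meson bounded_iff compact_imp_bounded imageI)
  have "AE t in Pi_meas k. norm (f t) \<le> B"
    using AE_Pi_abs_le_1 by eventually_elim (auto intro!: B)
  moreover have "f \<in> borel_measurable (Pi_meas k)"
    using borel_measurable_continuous_onI[OF assms] by simp
  ultimately show ?thesis by (intro integrable_const_bound)
qed

lemma Pi_integral_angle:
  fixes f :: "real \<Rightarrow> real"
  assumes f: "continuous_on UNIV f"
  shows "(\<integral>t. f t \<partial>Pi_meas k) =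
    integral {-pi..0} (\<lambda>\<theta>. f (Pi_radius k * cos \<theta>) * Pi_angle_density k \<theta>)"
proof -
  have [measurable]: "f \<in> borel_measurable borel" using borel_measurable_continuous_onI[OF f] .
  have int: "integrable lborel (\<lambda>t. Pi_density k t * f t)"
    using Pi_integrable_continuous[OF f, of k] unfolding Pi_meas_def
    by (subst (asm) integrable_density) (auto simp: Pi_density_nonneg)
  let ?g = "\<lambda>\<theta>. Pi_radius k * cos \<theta>" and ?g' = "\<lambda>\<theta>. - Pi_radius k * sin \<theta>"
  have si: "set_integrable lborel {?g (-pi)..?g 0} (\<lambda>t. Pi_density k t * f t)"
    unfolding set_integrable_def using int by (intro integrable_mult_indicator) auto
  note sub = integral_substitution[OF si cos_subst(1) cos_subst(2) cos_subst(3)]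
  have "(\<integral>t. f t \<partial>Pi_meas k) = (\<integral>t. Pi_density k t * f t \<partial>lborel)"
    unfolding Pi_meas_def by (subst integral_density) (auto simp: Pi_density_nonneg)
  also have "\<dots> = (\<integral>t. Pi_density k t * f t * indicator {?g (-pi)..?g 0} t \<partial>lborel)"
    by (intro Bochner_Integration.integral_cong) (auto simp: Pi_density_eq indicator_def)
  also have "\<dots> = (\<integral>\<theta>. Pi_density k (?g \<theta>) * f (?g \<theta>) * ?g' \<theta> * indicator {-pi..0} \<theta> \<partial>lborel)"
    using sub(2) by simp
  also have "\<dots> = (LINT \<theta>:{-pi..0}|lborel. Pi_density k (?g \<theta>) * f (?g \<theta>) * ?g' \<theta>)"
    by (simp add: set_lebesgue_integral_def mult.commute)
  also have "\<dots> = integral {-pi..0} (\<lambda>\<theta>. Pi_density k (?g \<theta>) * f (?g \<theta>) * ?g' \<theta>)"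
    using sub(1) by (intro set_borel_integral_eq_integral) simp
  also have "\<dots> = integral {-pi..0} (\<lambda>\<theta>. f (?g \<theta>) * Pi_angle_density k \<theta>)"
    by (simp add: Pi_angle_density_def mult_ac)
  finally show ?thesis .
qed

text \<open>With Chebyshev polynomials U of the second kind this says that \<open>CD k n\<close> is
  k U_n - U_(n-2) up to scaling. The factor sin keeps the identity free of division. The subtraction
  \<open>real n - 1\<close> is one of reals, so \<open>n = 0\<close> correctly yields the sine of
  the opposite angle.\<close>

lemma CD_cos:
  assumes k: "k \<ge> 1"
  shows "(real k + 1) * sqrt (real k) ^ n * (CD k n (Pi_radius k * cos \<theta>) * sin \<theta>) =
    real k * sin ((real n + 1) * \<theta>) - sin ((real n - 1) * \<theta>)"
proof (induction n rule: induct_nat_012)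
  case 0
  then show ?case by (simp add: algebra_simps)
next
  case 1
  have rad: "(real k + 1) * Pi_radius k = 2 * sqrt (real k)" by (simp add: Pi_radius_def)
  have "(real k + 1) * sqrt (real k) * (Pi_radius k * cos \<theta> * sin \<theta>) =
      2 * (sqrt (real k) * sqrt (real k)) * cos \<theta> * sin \<theta>"
  proof -
    have "(real k + 1) * sqrt (real k) * (Pi_radius k * cos \<theta> * sin \<theta>) =
      ((real k + 1) * Pi_radius k) * (sqrt (real k) * cos \<theta> * sin \<theta>)" by (simp only: mult_ac)
    also have "\<dots> = 2 * (sqrt (real k) * sqrt (real k)) * cos \<theta> * sin \<theta>"
      unfolding rad by (simp only: mult_ac)
    finally show ?thesis .
  qed
  also have "\<dots> = real k * sin (2 * \<theta>)" by (simp add: sin_double)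
  finally show ?case by simp
next
  case (ge2 n)
  let ?r = "sqrt (real k)" and ?c = "CD k" and ?t = "Pi_radius k * cos \<theta>"
  have rr: "?r * ?r = real k" by simp
  have rad: "(real k + 1) * Pi_radius k = 2 * ?r" by (simp add: Pi_radius_def)
  have sn: "2 * cos \<theta> * sin (m * \<theta>) = sin ((m + 1) * \<theta>) + sin ((m - 1) * \<theta>)" for m
    by (simp add: distrib_right left_diff_distrib sin_add sin_diff)
  have "(real k + 1) * ?r ^ Suc (Suc n) * (?c (Suc (Suc n)) ?t * sin \<theta>) =
     (real k + 1) * ?r ^ n * sin \<theta> * (real k * ?c (Suc (Suc n)) ?t)"
  proof -
    have "?r ^ Suc (Suc n) = real k * ?r ^ n" using rr by (simp flip: mult.assoc)
    then show ?thesis by (simp only: mult_ac)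
  qed
  also have "\<dots> = (real k + 1) * ?r ^ n * sin \<theta> * (((real k + 1) * Pi_radius k) * cos \<theta> * ?c (Suc n) ?t - ?c n ?t)"
    by (simp only: CD_rec[OF k]) (simp add: algebra_simps)
  also have "\<dots> = 2 * cos \<theta> * ((real k + 1) * ?r ^ Suc n * (?c (Suc n) ?t * sin \<theta>)) -
      (real k + 1) * ?r ^ n * (?c n ?t * sin \<theta>)"
    unfolding rad by (simp add: algebra_simps del: CD.simps)
  also have "\<dots> = 2 * cos \<theta> * (real k * sin ((real (Suc n) + 1) * \<theta>) - sin ((real (Suc n) - 1) * \<theta>)) -
      (real k * sin ((real n + 1) * \<theta>) - sin ((real n - 1) * \<theta>))"
    by (simp only: ge2)
  also have "\<dots> = real k * (2 * cos \<theta> * sin ((real n + 2) * \<theta>) - sin ((real n + 1) * \<theta>)) -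
     (2 * cos \<theta> * sin (real n * \<theta>) - sin ((real n - 1) * \<theta>))"
    by (simp add: algebra_simps)
  also have "\<dots> = real k * sin ((real n + 3) * \<theta>) - sin ((real n + 1) * \<theta>)"
    unfolding sn by (simp add: algebra_simps)
  finally show ?case by (simp add: algebra_simps del: CD.simps)
qed

lemma continuous_on_CD: "continuous_on S (CD k n)"
proof (induction n rule: induct_nat_012)
  case (ge2 n)
  then show ?case by (cases "k = 0") (auto intro!: continuous_intros)
qed auto

text \<open>The frequency is an integer because the index n - 2 occurs below for every natural
  n.\<close>

lemma integral_cos_multiple:
  "((\<lambda>\<theta>. cos (of_int m * \<theta>)) has_integral (if m = 0 then pi else 0)) {-pi..0}"
proof (cases "m = 0")
  case True
  then show ?thesis using has_integral_const_real[of "1::real" "-pi" 0] by simp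
next
  case False
  have "((\<lambda>\<theta>. cos (of_int m * \<theta>)) has_integral
      sin (of_int m * 0) / of_int m - sin (of_int m * (-pi)) / of_int m) {-pi..0}"
    using False by (intro fundamental_theorem_of_calculus)
      (auto intro!: derivative_eq_intros simp flip: has_real_derivative_iff_has_vector_derivative)
  then show ?thesis using False by (simp add: sin_times_pi_eq_0 mult.commute)
qed

text \<open>Clearing the denominator gives a second order recurrence for \<open>I = poisson_moment k\<close>; the
  difference \<open>D m = I (m + 2) - I m / k\<close> then satisfies \<open>D m = k * D (m - 2)\<close>, and
  boundedness of \<open>I\<close> forces \<open>D = 0\<close>.\<close>

definition poisson_moment :: "nat \<Rightarrow> int \<Rightarrow> real" where
  "poisson_moment k m =
     integral {-pi..0} (\<lambda>\<theta>. cos (of_int m * \<theta>) / ((real k)\<^sup>2 + 1 - 2 * real k * cos (2 * \<theta>)))"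

context
  fixes k :: nat
  assumes k2: "k \<ge> 2"
begin

text \<open>The minimum (k - 1)^2 is at least 1 for \<open>k \<ge> 2\<close>. For
  \<open>k = 1\<close> it is 0, which is why that case is done in
  \<open>Pi_integral_CD_1\<close>.\<close>

lemma poisson_denom_pos: "(real k)\<^sup>2 + 1 - 2 * real k * cos \<theta> \<ge> 1"
proof -
  have "2 * real k * cos \<theta> \<le> 2 * real k" by (simp add: mult_left_le)
  moreover have "(real k)\<^sup>2 \<ge> 2 * real k" using k2 by (simp add: power2_eq_square)
  ultimately show ?thesis by simp
qed

lemma poisson_moment_integrable:
  "(\<lambda>\<theta>. cos (of_int m * \<theta>) / ((real k)\<^sup>2 + 1 - 2 * real k * cos (2 * \<theta>))) integrable_on {-pi..0}"
proof (intro integrable_continuous_interval continuous_intros ballI)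
  fix \<theta> :: real show "(real k)\<^sup>2 + 1 - 2 * real k * cos (2 * \<theta>) \<noteq> 0"
    using poisson_denom_pos[of "2 * \<theta>"] by linarith
qed

lemma poisson_moment_bound: "\<bar>poisson_moment k m\<bar> \<le> pi"
proof -
  have "norm (poisson_moment k m) \<le> integral {-pi..0} (\<lambda>_::real. 1)"
    unfolding poisson_moment_def
  proof (rule integral_norm_bound_integral[OF poisson_moment_integrable])
    fix \<theta> :: real
    show "norm (cos (of_int m * \<theta>) / ((real k)\<^sup>2 + 1 - 2 * real k * cos (2 * \<theta>))) \<le> 1"
      using poisson_denom_pos[of "2 * \<theta>"] abs_cos_le_one[of "of_int m * \<theta>"]
      by (simp add: abs_divide divide_le_eq_1 del: abs_cos_le_one)
  qed auto
  then show ?thesis by simp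
qed

lemma poisson_moment_uminus: "poisson_moment k (- m) = poisson_moment k m"
  by (simp add: poisson_moment_def)

lemma poisson_moment_rec:
  "((real k)\<^sup>2 + 1) * poisson_moment k m - real k * (poisson_moment k (m + 2) + poisson_moment k (m - 2))
     = (if m = 0 then pi else 0)"
proof -
  let ?d = "\<lambda>\<theta>. (real k)\<^sup>2 + 1 - 2 * real k * cos (2 * \<theta>)"
  let ?f = "\<lambda>m \<theta>. cos (of_int m * \<theta>) / ?d \<theta>"
  have hi: "(?f m has_integral poisson_moment k m) {-pi..0}" for m
    unfolding poisson_moment_def using poisson_moment_integrable[of m] by blast
  have "((\<lambda>\<theta>. ((real k)\<^sup>2 + 1) * ?f m \<theta> - real k * (?f (m + 2) \<theta> + ?f (m - 2) \<theta>)) has_integral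
     ((real k)\<^sup>2 + 1) * poisson_moment k m - real k * (poisson_moment k (m + 2) + poisson_moment k (m - 2))) {-pi..0}"
    by (intro has_integral_diff has_integral_mult_right has_integral_add hi)
  moreover have "((real k)\<^sup>2 + 1) * ?f m \<theta> - real k * (?f (m + 2) \<theta> + ?f (m - 2) \<theta>) = cos (of_int m * \<theta>)" for \<theta>
  proof -
    have "?d \<theta> \<noteq> 0" using poisson_denom_pos[of "2 * \<theta>"] by linarith
    moreover have "cos (of_int (m + 2) * \<theta>) + cos (of_int (m - 2) * \<theta>) = 2 * cos (2 * \<theta>) * cos (of_int m * \<theta>)"
      by (simp add: distrib_right left_diff_distrib cos_add cos_diff)
    moreover have "((real k)\<^sup>2 + 1) * ?f m \<theta> - real k * (?f (m + 2) \<theta> + ?f (m - 2) \<theta>) =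
       (((real k)\<^sup>2 + 1) * cos (of_int m * \<theta>) -
         real k * (cos (of_int (m + 2) * \<theta>) + cos (of_int (m - 2) * \<theta>))) / ?d \<theta>"
      by (simp add: add_divide_distrib diff_divide_distrib algebra_simps)
    ultimately show ?thesis by (simp add: field_simps)
  qed
  ultimately have "((\<lambda>\<theta>. cos (of_int m * \<theta>)) has_integral
     ((real k)\<^sup>2 + 1) * poisson_moment k m - real k * (poisson_moment k (m + 2) + poisson_moment k (m - 2))) {-pi..0}"
    by simp
  then show ?thesis using integral_cos_multiple has_integral_unique by blast
qed

lemma poisson_moment_step:
  assumes "m \<ge> -1" shows "poisson_moment k (m + 2) = poisson_moment k m / real k"
proof -
  define D where "D m = poisson_moment k (m + 2) - poisson_moment k m / real k" for m
  \<comment> \<open>The recurrence is used at index \<open>m + 2 \<ge> 1\<close>, so the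
    inhomogeneous term at index 0 never appears.\<close>
  have step: "D (m + 2) = real k * D m" if "m \<ge> -1" for m
  proof -
    have "((real k)\<^sup>2 + 1) * poisson_moment k (m + 2) =
        real k * (poisson_moment k (m + 4) + poisson_moment k m)"
      using poisson_moment_rec[of "m + 2"] that by (simp add: add.commute)
    then show ?thesis using k2 by (simp add: D_def field_simps power2_eq_square)
  qed
  have iter: "D (m + 2 * int j) = real k ^ j * D m" for j
  proof (induction j)
    case (Suc j)
    have "D (m + 2 * int (Suc j)) = D ((m + 2 * int j) + 2)" by (simp add: algebra_simps)
    also have "\<dots> = real k * D (m + 2 * int j)" using assms by (intro step) simp
    finally show ?case using Suc by simp
  qed simp
  have bd: "\<bar>D m\<bar> \<le> 2 * pi" for m
  proof -
    have "\<bar>poisson_moment k m / real k\<bar> \<le> \<bar>poisson_moment k m\<bar>"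
      using k2 divide_left_mono[of 1 "real k" "\<bar>poisson_moment k m\<bar>"] by (simp add: abs_divide)
    then show ?thesis unfolding D_def
      using poisson_moment_bound[of m] poisson_moment_bound[of "m + 2"] by linarith
  qed
  have "D m = 0"
  proof (rule ccontr)
    assume "D m \<noteq> 0"
    obtain j where "2 * pi / \<bar>D m\<bar> < real k ^ j"
      using real_arch_pow[of "real k"] k2 by auto
    then have "2 * pi < \<bar>D (m + 2 * int j)\<bar>"
      unfolding iter using \<open>D m \<noteq> 0\<close> by (simp add: abs_mult field_simps)
    then show False using bd[of "m + 2 * int j"] by simp
  qed
  then show ?thesis by (simp add: D_def)
qed

text \<open>Products of sines turn the integrand into moments of index n, n + 2 and n - 2. For
  positive n each step of two divides the moment by k, and k + 1 - 1 - k = 0. The step is then taken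
  from n - 2, which is -1 for n = 1; this explains the range in \<open>poisson_moment_step\<close>.
  For n = 0 the moments of index 2 and -2 coincide, and the inhomogeneous term of the recurrence
  gives the total mass 1.\<close>

lemma Pi_integral_CD_ge2: "(\<integral>t. CD k n t \<partial>Pi_meas k) = (if n = 0 then 1 else 0)"
proof -
  let ?r = "sqrt (real k) ^ n" and ?I = "poisson_moment k"
  let ?d = "\<lambda>\<theta>. (real k)\<^sup>2 + 1 - 2 * real k * cos (2 * \<theta>)"
  let ?c = "\<lambda>m \<theta>. cos (of_int m * \<theta>) / ?d \<theta>"
  have k1: "k \<ge> 1" and r: "?r > 0" using k2 by simp_all
  have eq: "CD k n (Pi_radius k * cos \<theta>) * Pi_angle_density k \<theta> =
      real k / (pi * ?r) * ((real k + 1) * ?c (int n) \<theta> - real k * ?c (int n + 2) \<theta> - ?c (int n - 2) \<theta>)"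
    if \<theta>: "\<theta> \<in> {-pi..0}" for \<theta>
  proof -
    let ?P = "CD k n (Pi_radius k * cos \<theta>)"
    have d: "?d \<theta> > 0" using poisson_denom_pos[of "2 * \<theta>"] by linarith
    have "?d \<theta> = (real k + 1)\<^sup>2 - 4 * real k * (cos \<theta>)\<^sup>2"
      unfolding cos_double_cos by (simp add: power2_eq_square algebra_simps)
    then have d': "1 - (Pi_radius k)\<^sup>2 * (cos \<theta>)\<^sup>2 = ?d \<theta> / (real k + 1)\<^sup>2"
      by (simp add: Pi_radius_sq field_simps)
    have "Pi_angle_density k \<theta> = (real k + 1) / (2 * pi) * (4 * real k * (sin \<theta>)\<^sup>2 / ?d \<theta>)"
      unfolding Pi_angle_density_eq[OF \<theta>] d' by (simp add: Pi_radius_sq)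
    moreover have "p * ((real k + 1) / (2 * pi) * (4 * real k * s\<^sup>2 / d)) =
        2 * real k / (pi * r * d) * ((real k + 1) * r * (p * s) * s)" if "d > 0" "r > 0" for p s d r
      using that by (simp add: power2_eq_square field_simps)
    ultimately have "?P * Pi_angle_density k \<theta> =
        2 * real k / (pi * ?r * ?d \<theta>) * ((real k + 1) * ?r * (?P * sin \<theta>) * sin \<theta>)"
      using d r by simp
    also have "\<dots> = 2 * real k / (pi * ?r * ?d \<theta>) *
       ((real k * sin ((real n + 1) * \<theta>) - sin ((real n - 1) * \<theta>)) * sin \<theta>)"
      by (simp only: CD_cos[OF k1])
    also have "(real k * sin ((real n + 1) * \<theta>) - sin ((real n - 1) * \<theta>)) * sin \<theta> =
       real k * (sin ((real n + 1) * \<theta>) * sin \<theta>) - sin ((real n - 1) * \<theta>) * sin \<theta>"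
      by (simp add: algebra_simps)
    also have "sin ((real n + 1) * \<theta>) * sin \<theta> = (cos (real n * \<theta>) - cos ((real n + 2) * \<theta>)) / 2"
      by (simp add: sin_times_sin algebra_simps)
    also have "sin ((real n - 1) * \<theta>) * sin \<theta> = (cos ((real n - 2) * \<theta>) - cos (real n * \<theta>)) / 2"
    proof -
      have "(real n - 1) * \<theta> - \<theta> = (real n - 2) * \<theta>" "(real n - 1) * \<theta> + \<theta> = real n * \<theta>"
        by (simp_all add: algebra_simps)
      then show ?thesis by (simp only: sin_times_sin)
    qed
    also have "2 * real k / (pi * r * d) * (real k * ((a - b) / 2) - (c - a) / 2) =
        real k / (pi * r) * ((real k + 1) * (a / d) - real k * (b / d) - c / d)"
      if "d > 0" "r > 0" for a b c d r
      using that by (simp add: field_simps)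
    note this[OF d r]
    finally show ?thesis by simp
  qed
  have hi: "(?c m has_integral ?I m) {-pi..0}" for m
    unfolding poisson_moment_def using poisson_moment_integrable[of m] by blast
  have "((\<lambda>\<theta>. real k / (pi * ?r) *
        ((real k + 1) * ?c (int n) \<theta> - real k * ?c (int n + 2) \<theta> - ?c (int n - 2) \<theta>)) has_integral
      real k / (pi * ?r) * ((real k + 1) * ?I (int n) - real k * ?I (int n + 2) - ?I (int n - 2))) {-pi..0}"
    by (intro has_integral_diff has_integral_mult_right has_integral_add hi)
  then have "((\<lambda>\<theta>. CD k n (Pi_radius k * cos \<theta>) * Pi_angle_density k \<theta>) has_integral
      real k / (pi * ?r) * ((real k + 1) * ?I (int n) - real k * ?I (int n + 2) - ?I (int n - 2))) {-pi..0}"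
    by (rule has_integral_eq[rotated]) (rule eq[symmetric])
  then have *: "(\<integral>t. CD k n t \<partial>Pi_meas k) =
      real k / (pi * ?r) * ((real k + 1) * ?I (int n) - real k * ?I (int n + 2) - ?I (int n - 2))"
    using Pi_integral_angle[OF continuous_on_CD] integral_unique by metis
  have up: "?I (int n + 2) = ?I (int n) / real k" by (rule poisson_moment_step) simp
  show ?thesis
  proof (cases "n = 0")
    case True
    have "((real k)\<^sup>2 - 1) * ?I 0 = pi"
      using poisson_moment_rec[of 0] poisson_moment_uminus[of 2] up True k2
      by (simp add: algebra_simps)
    moreover have "real k * ((real k + 1) * ?I 0 - real k * (?I 0 / real k) - ?I 0 / real k) = ((real k)\<^sup>2 - 1) * ?I 0"
      using k2 by (simp add: field_simps power2_eq_square)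
    ultimately show ?thesis using * up True poisson_moment_uminus[of 2] by simp
  next
    case False
    then have "?I (int n) = ?I (int n - 2) / real k"
      using poisson_moment_step[of "int n - 2"] by simp
    then show ?thesis using * up False k2 by (simp add: field_simps)
  qed
qed

end

text \<open>On the line the polynomials are Chebyshev polynomials of the first kind and the angle
  density is the constant 1 / pi. At the end points of the interval the density evaluates to 0
  instead, so the comparison is made on the open interval only.\<close>

lemma Pi_integral_CD_1: "(\<integral>t. CD 1 n t \<partial>Pi_meas 1) = (if n = 0 then 1 else 0)"
proof -
  have eq: "CD 1 n (Pi_radius 1 * cos \<theta>) * Pi_angle_density 1 \<theta> = cos (of_int (int n) * \<theta>) / pi"
    if \<theta>: "\<theta> \<in> {-pi<..<0}" for \<theta>
  proof -
    have s: "sin \<theta> \<noteq> 0" using sin_gt_zero[of "- \<theta>"] \<theta> by simp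
    have R: "Pi_radius 1 = 1" by (simp add: Pi_radius_def)
    have "Pi_angle_density 1 \<theta> = 1 / pi"
      using s \<theta> Pi_angle_density_eq[of \<theta> 1] unfolding R by (simp flip: sin_squared_eq)
    moreover have "2 * CD 1 n (cos \<theta>) * sin \<theta> = 2 * cos (real n * \<theta>) * sin \<theta>"
      using CD_cos[of 1 n \<theta>] unfolding R by (simp add: distrib_right left_diff_distrib sin_add sin_diff)
    ultimately show ?thesis using s unfolding R by simp
  qed
  have "((\<lambda>\<theta>. cos (of_int (int n) * \<theta>) / pi) has_integral (if int n = 0 then pi else 0) / pi) {-pi..0}"
    by (intro has_integral_divide integral_cos_multiple)
  then have "((\<lambda>\<theta>. CD 1 n (Pi_radius 1 * cos \<theta>) * Pi_angle_density 1 \<theta>) has_integral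
      (if int n = 0 then pi else 0) / pi) {-pi..0}"
    using eq has_integral_spike_interior[of _ _ "-pi" 0] by (metis (no_types, lifting) box_real(1) cbox_interval)
  then show ?thesis using Pi_integral_angle[OF continuous_on_CD, of 1 1 n] by (simp add: integral_unique)
qed

lemma Pi_integral_CD:
  "k \<ge> 1 \<Longrightarrow> (\<integral>t. CD k n t \<partial>Pi_meas k) = (if n = 0 then 1 else 0)"
  using Pi_integral_CD_1[of n] Pi_integral_CD_ge2[of k n] by (cases "k = 1") auto

section \<open>Polynomial test functions and orthogonality\<close>

lemma integrable_bounded_mult:
  fixes f g :: "'a \<Rightarrow> 'b::{banach,second_countable_topology,real_normed_algebra}"
  assumes f: "integrable M f" and [measurable]: "g \<in> borel_measurable M"
    and bd: "AE x in M. norm (g x) \<le> C"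
  shows "integrable M (\<lambda>x. g x * f x)"
proof (rule Bochner_Integration.integrable_bound)
  show "integrable M (\<lambda>x. \<bar>C\<bar> * norm (f x))" using f by simp
  show "(\<lambda>x. g x * f x) \<in> borel_measurable M" using f by simp
  show "AE x in M. norm (g x * f x) \<le> norm (\<bar>C\<bar> * norm (f x))"
    using bd
  proof eventually_elim
    fix x assume "norm (g x) \<le> C"
    then have "norm (g x) * norm (f x) \<le> \<bar>C\<bar> * norm (f x)" by (intro mult_right_mono) auto
    then show "norm (g x * f x) \<le> norm (\<bar>C\<bar> * norm (f x))"
      using norm_mult_ineq[of "g x" "f x"] by (simp add: abs_mult)
  qed
qed

section \<open>Nonnegativity tested on squares of polynomials\<close>

context
  fixes M :: "real measure" and w :: "real \<Rightarrow> real"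
  assumes sets_M: "sets M = sets borel" and supp: "AE t in M. \<bar>t\<bar> \<le> 1"
    and w: "integrable M w"
    and poly_nonneg: "\<And>p. real_polynomial_function p \<Longrightarrow> 0 \<le> (\<integral>t. w t * (p t)\<^sup>2 \<partial>M)"
begin

text \<open>Weierstrass is applied to the square root of \<open>h\<close>, not to \<open>h\<close>,
  so that the approximants are squares and the assumption applies to them.\<close>

lemma continuous_test_nonneg:
  assumes h: "continuous_on UNIV h" and h0: "\<And>t. 0 \<le> h t"
  shows "0 \<le> (\<integral>t. w t * h t \<partial>M)"
proof -
  note sets_M [measurable_cong]
  have "\<exists>p. real_polynomial_function p \<and> (\<forall>t\<in>{-1..1}. \<bar>sqrt (h t) - p t\<bar> < inverse (real (Suc n)))" for n
  proof -
    have "continuous_on {-1..1} (\<lambda>t. sqrt (h t))"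
      using h by (intro continuous_intros) (auto intro: continuous_on_subset)
    then show ?thesis
      using Stone_Weierstrass_real_polynomial_function[of "{-1..1}" "\<lambda>t. sqrt (h t)" "inverse (real (Suc n))"]
      by (metis compact_Icc inverse_positive_iff_positive of_nat_0_less_iff zero_less_Suc)
  qed
  then obtain p where p: "\<And>n. real_polynomial_function (p n)"
    and pe: "\<And>n t. t \<in> {-1..1} \<Longrightarrow> \<bar>sqrt (h t) - p n t\<bar> < inverse (real (Suc n))"
    by metis
  have [measurable]: "p n \<in> borel_measurable borel" "h \<in> borel_measurable borel" "w \<in> borel_measurable M" for n
    using p[of n] h w
    by (auto intro!: borel_measurable_continuous_onI continuous_on_polymonial_function
        simp: real_polynomial_function_eq)
  have "compact (h ` {-1..1})"
    using h by (intro compact_continuous_image) (auto intro: continuous_on_subset)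
  then obtain B where B: "\<And>t. t \<in> {-1..1} \<Longrightarrow> \<bar>h t\<bar> \<le> B"
    by (metis bounded_iff compact_imp_bounded imageI real_norm_def)
  have "(\<lambda>n. \<integral>t. w t * (p n t)\<^sup>2 \<partial>M) \<longlonglongrightarrow> (\<integral>t. w t * h t \<partial>M)"
  proof (rule integral_dominated_convergence[where w = "\<lambda>t. (sqrt B + 1)\<^sup>2 * \<bar>w t\<bar>"])
    show "AE t in M. (\<lambda>n. w t * (p n t)\<^sup>2) \<longlonglongrightarrow> w t * h t"
      using supp
    proof eventually_elim
      fix t :: real assume "\<bar>t\<bar> \<le> 1"
      then have t: "t \<in> {-1..1}" by auto
      have "(\<lambda>n. sqrt (h t) - p n t) \<longlonglongrightarrow> 0"
        using pe[OF t] by (intro Lim_null_comparison[OF _ LIMSEQ_inverse_real_of_nat])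
          (auto intro!: always_eventually less_imp_le)
      then have "(\<lambda>n. sqrt (h t) - (sqrt (h t) - p n t)) \<longlonglongrightarrow> sqrt (h t) - 0"
        by (intro tendsto_intros)
      then have "(\<lambda>n. w t * (p n t)\<^sup>2) \<longlonglongrightarrow> w t * (sqrt (h t))\<^sup>2" by (intro tendsto_intros) simp
      then show "(\<lambda>n. w t * (p n t)\<^sup>2) \<longlonglongrightarrow> w t * h t" using h0 by simp
    qed
    show "AE t in M. norm (w t * (p n t)\<^sup>2) \<le> (sqrt B + 1)\<^sup>2 * \<bar>w t\<bar>" for n
      using supp
    proof eventually_elim
      fix t :: real assume "\<bar>t\<bar> \<le> 1"
      then have t: "t \<in> {-1..1}" by auto
      have "sqrt (h t) \<le> sqrt B" using B[OF t] by simp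
      moreover have "inverse (real (Suc n)) \<le> 1" by (simp add: field_simps)
      ultimately have "\<bar>p n t\<bar> \<le> sqrt B + 1" using pe[OF t, of n] h0[of t]
        by (smt (verit) real_sqrt_ge_0_iff)
      then have "(p n t)\<^sup>2 \<le> (sqrt B + 1)\<^sup>2" 
        by (metis abs_ge_zero power2_abs power_mono)
      then show "norm (w t * (p n t)\<^sup>2) \<le> (sqrt B + 1)\<^sup>2 * \<bar>w t\<bar>"
        by (simp add: abs_mult mult.commute mult_left_mono)
    qed
  qed (use w in auto)
  then show ?thesis
    by (rule LIMSEQ_le_const) (use p poly_nonneg in auto)
qed

text \<open>The indicator of \<open>K\<close> is the decreasing limit of continuous tents
  \<open>h n\<close> built from the distance to \<open>K\<close>; they are bounded by 1, so
  \<open>w\<close> itself dominates.\<close>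

lemma compact_test_nonneg:
  assumes K: "compact K"
  shows "0 \<le> (\<integral>t. w t * indicator K t \<partial>M)"
proof (cases "K = {}")
  case False
  note sets_M [measurable_cong]
  have [measurable]: "K \<in> sets borel" "w \<in> borel_measurable M"
    using K w by (auto intro: borel_compact)
  define h where "h n t = max 0 (1 - real n * infdist t K)" for n t
  have cont: "continuous_on UNIV (h n)" for n
    unfolding h_def by (intro continuous_intros)
  have [measurable]: "h n \<in> borel_measurable borel" for n
    by (rule borel_measurable_continuous_onI[OF cont])
  have "(\<lambda>n. \<integral>t. w t * h n t \<partial>M) \<longlonglongrightarrow> (\<integral>t. w t * indicator K t \<partial>M)"
  proof (rule integral_dominated_convergence[where w = "\<lambda>t. \<bar>w t\<bar>"])
    show "AE t in M. (\<lambda>n. w t * h n t) \<longlonglongrightarrow> w t * indicator K t"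
    proof (intro AE_I2 tendsto_intros)
      fix t
      show "(\<lambda>n. h n t) \<longlonglongrightarrow> indicator K t"
      proof (cases "t \<in> K")
        case True
        then show ?thesis by (simp add: h_def)
      next
        case t: False
        then have "infdist t K > 0"
          using K False compact_imp_closed in_closed_iff_infdist_zero infdist_nonneg
          by (metis less_eq_real_def)
        then obtain N where N: "1 < real N * infdist t K" using reals_Archimedean3 by blast
        have "\<forall>\<^sub>F n in sequentially. h n t = indicator K t"
          using eventually_ge_at_top[of N]
        proof eventually_elim
          case (elim n)
          then have "real N * infdist t K \<le> real n * infdist t K"
            by (intro mult_right_mono infdist_nonneg) simp
          then show ?case using N t by (simp add: h_def)
        qed
        then show ?thesis by (rule tendsto_eventually)
      qed
    qed
    show "AE t in M. norm (w t * h n t) \<le> \<bar>w t\<bar>" for n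
      using infdist_nonneg[of _ K] by (intro AE_I2) (auto simp: h_def abs_mult intro!: mult_left_le)
  qed (use w in auto)
  then show ?thesis
    by (rule LIMSEQ_le_const)
      (use continuous_test_nonneg[OF cont] in \<open>auto simp: h_def\<close>)
qed simp

lemma AE_nonneg_if_poly_nonneg: "AE t in M. 0 \<le> w t"
proof -
  note sets_M [measurable_cong]
  have [measurable]: "w \<in> borel_measurable M" using w by simp
  then have wb [measurable]: "w \<in> borel_measurable borel" using measurable_cong_sets[OF sets_M refl] by blast
  define B where "B = {t. w t < 0}"
  have [measurable]: "B \<in> sets borel" unfolding B_def by measurable
  \<comment> \<open>Only compact sets have been tested. Since \<open>w\<close> is integrable,
    \<open>N\<close> is finite and hence inner regular, so it suffices that compact parts of
    \<open>B\<close> are null. On such a part the mass is minus the integral of \<open>w\<close>,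
    thus both nonnegative and nonpositive.\<close>
  define N where "N = density M (\<lambda>t. ennreal \<bar>w t\<bar>)"
  have sN: "sets N = sets borel" by (simp add: N_def sets_M)
  have fin: "emeasure N (space N) \<noteq> \<infinity>"
    using w unfolding N_def
    by (simp add: emeasure_density integrable_iff_bounded cong: nn_integral_cong)
  have "emeasure N K = 0" if K: "K \<subseteq> B" "compact K" for K
  proof -
    have [measurable]: "K \<in> sets borel" using K by (auto intro: borel_compact)
    have "emeasure N K = (\<integral>\<^sup>+ t. ennreal \<bar>w t\<bar> * indicator K t \<partial>M)"
      unfolding N_def by (rule emeasure_density) auto
    also have "\<dots> = (\<integral>\<^sup>+ t. ennreal (- (w t * indicator K t)) \<partial>M)"
      using K by (intro nn_integral_cong) (auto simp: B_def indicator_def)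
    also have "\<dots> = ennreal (\<integral>t. - (w t * indicator K t) \<partial>M)"
    proof (rule nn_integral_eq_integral)
      show "integrable M (\<lambda>t. - (w t * indicator K t))"
        using w by (intro integrable_minus integrable_real_mult_indicator) auto
      show "AE t in M. 0 \<le> - (w t * indicator K t)"
        using K by (intro AE_I2) (auto simp: B_def indicator_def)
    qed
    also have "\<dots> = 0" using compact_test_nonneg[OF K(2)] by (simp add: ennreal_eq_0_iff)
    finally show ?thesis .
  qed
  moreover have "emeasure N B = (SUP K \<in> {K. K \<subseteq> B \<and> compact K}. emeasure N K)"
    by (rule inner_regular[OF sN fin]) simp
  ultimately have "emeasure N B = 0" by (simp add: SUP_constant bot_ennreal)
  then have "AE t in M. ennreal \<bar>w t\<bar> * indicator B t = 0"
    unfolding N_def by (subst (asm) emeasure_density) (auto simp: nn_integral_0_iff_AE)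
  then show ?thesis
    by eventually_elim (auto simp: B_def indicator_def split: if_splits)
qed

end

section \<open>Orthogonality of the polynomials\<close>

lemma CD_measurable [measurable]: "CD k n \<in> borel_measurable borel"
  by (rule borel_measurable_continuous_onI) (rule continuous_on_CD)

lemma measure_Pi_UNIV: "k \<ge> 1 \<Longrightarrow> measure (Pi_meas k) UNIV = 1"
  using Pi_integral_CD[of k 0] by simp

lemma integrable_CD_mult_CD: "integrable (Pi_meas k) (\<lambda>t. CD k m t * CD k n t)"
  by (intro Pi_integrable_continuous continuous_intros continuous_on_CD)

text \<open>The recurrence is used twice, to move a factor t from the first polynomial onto the
  second. This lowers \<open>m\<close>, at the cost of changing \<open>n\<close>, until the integral
  of a single \<open>CD\<close> is left.\<close>

lemma CD_orthogonal:
  assumes k: "k \<ge> 1"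
  shows "(\<integral>t. CD k m t * CD k n t \<partial>Pi_meas k) = (if m = n then 1 / sphere_card k n else 0)"
proof (induction m arbitrary: n rule: induct_nat_012)
  case 0
  then show ?case using Pi_integral_CD[OF k, of n] by (simp add: sphere_card_def)
next
  case 1
  show ?case
  proof (cases n)
    case 0
    then show ?thesis using Pi_integral_CD[OF k, of 1] by simp
  next
    case (Suc n')
    have "CD k (Suc 0) t * CD k n t = (real k * CD k (Suc n) t + CD k n' t) / (real k + 1)" for t
      using CD_rec[OF k, of n' t] by (simp add: Suc field_simps del: CD.simps(3))
    then have "(\<integral>t. CD k (Suc 0) t * CD k n t \<partial>Pi_meas k) =
       (\<integral>t. (real k * CD k (Suc n) t + CD k n' t) / (real k + 1) \<partial>Pi_meas k)" by simp
    also have "\<dots> = (real k * (\<integral>t. CD k (Suc n) t \<partial>Pi_meas k) + (\<integral>t. CD k n' t \<partial>Pi_meas k)) / (real k + 1)"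
      using Pi_integrable_continuous[OF continuous_on_CD, of k k] by (simp del: CD.simps)
    finally show ?thesis using Suc by (simp add: Pi_integral_CD[OF k] sphere_card_def del: CD.simps)
  qed
next
  case (ge2 m)
  show ?case
  proof (cases n)
    case 0
    then show ?thesis using Pi_integral_CD[OF k, of "Suc (Suc m)"] by (simp del: CD.simps(3))
  next
    case (Suc n')
    have "real k * (CD k (Suc (Suc m)) t * CD k n t) =
        real k * (CD k (Suc m) t * CD k (Suc n) t) + CD k (Suc m) t * CD k n' t - CD k m t * CD k n t" for t
    proof -
      have "real k * (CD k (Suc (Suc m)) t * CD k n t) = (real k * CD k (Suc (Suc m)) t) * CD k n t" by simp
      also have "\<dots> = CD k (Suc m) t * ((real k + 1) * t * CD k n t) - CD k m t * CD k n t"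
        by (simp only: CD_rec[OF k]) (simp add: algebra_simps del: CD.simps(3))
      also have "(real k + 1) * t * CD k n t = real k * CD k (Suc n) t + CD k n' t"
        using CD_rec[OF k, of n' t] by (simp add: Suc del: CD.simps(3))
      finally show ?thesis by (simp add: algebra_simps del: CD.simps(3))
    qed
    then have "(\<integral>t. real k * (CD k (Suc (Suc m)) t * CD k n t) \<partial>Pi_meas k) =
      (\<integral>t. real k * (CD k (Suc m) t * CD k (Suc n) t) + CD k (Suc m) t * CD k n' t - CD k m t * CD k n t \<partial>Pi_meas k)"
      by simp
    then have "real k * (\<integral>t. CD k (Suc (Suc m)) t * CD k n t \<partial>Pi_meas k) =
       real k * (\<integral>t. CD k (Suc m) t * CD k (Suc n) t \<partial>Pi_meas k) +
       (\<integral>t. CD k (Suc m) t * CD k n' t \<partial>Pi_meas k) - (\<integral>t. CD k m t * CD k n t \<partial>Pi_meas k)"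
      using integrable_CD_mult_CD by (simp del: CD.simps(3))
    \<comment> \<open>For \<open>m = n\<close> the first and the last term cancel, because spheres
      of positive radius grow by the factor \<open>k\<close>; the middle term survives exactly when
      \<open>n = m + 2\<close>.\<close>
    also have "\<dots> = real k * (if Suc (Suc m) = n then 1 / sphere_card k n else 0)"
      unfolding ge2 using k Suc by (auto simp: sphere_card_Suc field_simps)
    finally show ?thesis using k by (simp del: CD.simps(3))
  qed
qed

section \<open>Bounded kernels\<close>

abbreviation sq_sum :: "'a set \<Rightarrow> ('a \<Rightarrow> complex) \<Rightarrow> real" where
  "sq_sum F f \<equiv> \<Sum>x\<in>F. (cmod (f x))\<^sup>2"

lemma cnj_mult_self: "cnj z * z = complex_of_real ((cmod z)\<^sup>2)"
  by (simp only: complex_norm_square mult.commute)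

lemma summable_on_mult_l2:
  fixes f g :: "'a \<Rightarrow> complex"
  assumes "(\<lambda>x. (cmod (f x))\<^sup>2) summable_on V" "(\<lambda>x. (cmod (g x))\<^sup>2) summable_on V"
  shows "(\<lambda>x. f x * g x) summable_on V"
proof -
  have "(\<lambda>x. (cmod (f x))\<^sup>2 + (cmod (g x))\<^sup>2) summable_on V"
    using assms by (rule summable_on_add)
  then have "(\<lambda>x. norm (f x * g x)) summable_on V"
  proof (rule summable_on_comparison_test)
    fix x
    have "0 \<le> (cmod (f x) - cmod (g x))\<^sup>2 + (cmod (f x))\<^sup>2 + (cmod (g x))\<^sup>2" by simp
    then show "norm (f x * g x) \<le> (cmod (f x))\<^sup>2 + (cmod (g x))\<^sup>2"
      by (simp add: norm_mult power2_diff)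
  qed simp
  then show ?thesis by (rule abs_summable_summable)
qed

text \<open>The hypothesis has a sum of squares rather than a product of norms because this is what
  \<open>radial_form_bound\<close> delivers; scaling one argument recovers an operator
  bound.\<close>

lemma bounded_kernelI:
  fixes K :: "'a \<Rightarrow> 'a \<Rightarrow> complex"
  assumes C: "C > 0"
    and form: "\<And>F f g. finite F \<Longrightarrow> F \<subseteq> V \<Longrightarrow>
      cmod (\<Sum>y\<in>F. cnj (g y) * (\<Sum>x\<in>F. f x * K y x)) \<le> C * (sq_sum F f + sq_sum F g)"
  shows "bounded_kernel V K"
proof -
  have fin: "sq_sum F (\<lambda>y. \<Sum>x\<in>G. f x * K y x) \<le> 4 * C\<^sup>2 * sq_sum G f"
    if F: "finite F" "F \<subseteq> V" and G: "finite G" "G \<subseteq> V" for F G f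
  proof -
    define u where "u y = (\<Sum>x\<in>G. f x * K y x)" for y
    define f' where "f' x = (if x \<in> G then f x else 0)" for x
    \<comment> \<open>The factor 1 / (2C) balances the two sides: for the squared norms U of
      \<open>u\<close> and S of \<open>f\<close> the hypothesis reads U / (2C) \<le> C S + U / (4C),
      that is U \<le> 4 C^2 S.\<close>
    define g' where "g' x = (if x \<in> F then complex_of_real (1 / (2 * C)) * u x else 0)" for x
    let ?E = "F \<union> G"
    have E: "finite ?E" "?E \<subseteq> V" using F G by auto
    have 1: "(\<Sum>x\<in>?E. f' x * K y x) = u y" for y
      unfolding u_def f'_def using E by (intro sum.mono_neutral_cong_right) auto
    have 2: "(\<Sum>y\<in>?E. cnj (g' y) * u y) = complex_of_real (1 / (2 * C) * sq_sum F u)"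
    proof -
      have sc: "cnj (complex_of_real a * z) * z = complex_of_real (a * (cmod z)\<^sup>2)" for a z
        by (simp only: complex_cnj_mult complex_cnj_complex_of_real of_real_mult complex_norm_square mult_ac)
      have "(\<Sum>y\<in>?E. cnj (g' y) * u y) = (\<Sum>y\<in>F. complex_of_real (1 / (2 * C) * (cmod (u y))\<^sup>2))"
        unfolding g'_def using E sc
        by (intro sum.mono_neutral_cong_right) (auto simp del: of_real_divide of_real_mult complex_cnj_mult)
      then show ?thesis by (simp only: of_real_sum sum_distrib_left)
    qed
    have 3: "sq_sum ?E f' = sq_sum G f"
      unfolding f'_def using E by (intro sum.mono_neutral_cong_right) auto
    have 4: "sq_sum ?E g' = (1 / (2 * C))\<^sup>2 * sq_sum F u"
    proof -
      have "sq_sum ?E g' = (\<Sum>x\<in>F. (1 / (2 * C))\<^sup>2 * (cmod (u x))\<^sup>2)"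
        unfolding g'_def using E C
        by (intro sum.mono_neutral_cong_right)
          (auto simp: norm_mult power_mult_distrib norm_divide power_divide)
      then show ?thesis by (simp only: sum_distrib_left)
    qed
    have "1 / (2 * C) * sq_sum F u \<le> C * (sq_sum G f + (1 / (2 * C))\<^sup>2 * sq_sum F u)"
      using form[OF E, of g' f'] C unfolding 1 2 3 4 norm_of_real
      by (simp add: sum_nonneg abs_of_nonneg)
    then show ?thesis using C unfolding u_def[symmetric]
      by (simp add: field_simps power2_eq_square)
  qed
  \<comment> \<open>Testing a row against its own conjugate gives S^2 \<le> 4 C^2 S for its finite
    square sums S. Square summable rows make the kernel applicable to every square summable
    \<open>f\<close>, not only to finite supports.\<close>
  have row: "(\<lambda>x. (cmod (K y x))\<^sup>2) summable_on V" if y: "y \<in> V" for y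
  proof (rule nonneg_bdd_above_summable_on)
    show "bdd_above (sum (\<lambda>x. (cmod (K y x))\<^sup>2) ` {G. G \<subseteq> V \<and> finite G})"
    proof (rule bdd_aboveI2)
      fix G assume "G \<in> {G. G \<subseteq> V \<and> finite G}"
      then have G: "finite G" "G \<subseteq> V" by auto
      let ?S = "sq_sum G (K y)"
      have "(\<Sum>x\<in>G. cnj (K y x) * K y x) = complex_of_real ?S"
        by (simp only: cnj_mult_self of_real_sum)
      then have "cmod (\<Sum>x\<in>G. cnj (K y x) * K y x) = ?S"
        by (simp only: norm_of_real) (simp add: sum_nonneg)
      then have "?S\<^sup>2 \<le> 4 * C\<^sup>2 * ?S"
        using fin[of "{y}" G "\<lambda>x. cnj (K y x)"] y G by simp
      moreover have "?S \<ge> 0" by (simp add: sum_nonneg)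
      ultimately show "?S \<le> 4 * C\<^sup>2" using C
        by (cases "?S = 0") (auto simp: power2_eq_square)
    qed
  qed simp
  have sm: "(\<lambda>x. K y x * f x) summable_on V" if "f \<in> l2 V" "y \<in> V" for f y
    using that row by (intro summable_on_mult_l2) (auto simp: l2_def)
  \<comment> \<open>The finite estimate passes to the limit in the inner set first, with the outer
    set \<open>F\<close> fixed.\<close>
  have main: "sq_sum F (apply_kernel V K f) \<le> 4 * C\<^sup>2 * (\<Sum>\<^sub>\<infinity>x\<in>V. (cmod (f x))\<^sup>2)"
    if f: "f \<in> l2 V" and F: "finite F" "F \<subseteq> V" for f F
  proof (rule tendsto_upperbound)
    show "((\<lambda>G. sq_sum F (\<lambda>y. \<Sum>x\<in>G. K y x * f x)) \<longlongrightarrow> sq_sum F (apply_kernel V K f)) (finite_subsets_at_top V)"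
      unfolding apply_kernel_def
      using sm[OF f] F
      by (intro tendsto_intros infsum_tendsto) auto
    show "\<forall>\<^sub>F G in finite_subsets_at_top V. sq_sum F (\<lambda>y. \<Sum>x\<in>G. K y x * f x)
        \<le> 4 * C\<^sup>2 * (\<Sum>\<^sub>\<infinity>x\<in>V. (cmod (f x))\<^sup>2)"
    proof (rule eventually_finite_subsets_at_top_weakI)
      fix G assume G: "finite G" "G \<subseteq> V"
      have "sq_sum G f \<le> (\<Sum>\<^sub>\<infinity>x\<in>V. (cmod (f x))\<^sup>2)"
        using f G by (intro finite_sum_le_infsum) (auto simp: l2_def)
      then have "4 * C\<^sup>2 * sq_sum G f \<le> 4 * C\<^sup>2 * (\<Sum>\<^sub>\<infinity>x\<in>V. (cmod (f x))\<^sup>2)"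
        by (intro mult_left_mono) auto
      then show "sq_sum F (\<lambda>y. \<Sum>x\<in>G. K y x * f x) \<le> 4 * C\<^sup>2 * (\<Sum>\<^sub>\<infinity>x\<in>V. (cmod (f x))\<^sup>2)"
        using fin[OF F G, of f] by (simp add: mult.commute)
    qed
  qed simp
  show ?thesis
    unfolding bounded_kernel_def
  proof (intro exI[of _ "2 * C"] ballI conjI)
    fix f assume f: "f \<in> l2 V"
    show "(\<lambda>x. K y x * f x) summable_on V" if "y \<in> V" for y
      by (rule sm[OF f that])
    have sq: "(\<lambda>x. (cmod (apply_kernel V K f x))\<^sup>2) summable_on V"
      by (rule nonneg_bdd_above_summable_on) (use main[OF f] in \<open>auto intro!: bdd_aboveI2\<close>)
    then show "apply_kernel V K f \<in> l2 V" by (simp add: l2_def)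
    have "(\<Sum>\<^sub>\<infinity>x\<in>V. (cmod (apply_kernel V K f x))\<^sup>2) \<le> (2 * C)\<^sup>2 * (\<Sum>\<^sub>\<infinity>x\<in>V. (cmod (f x))\<^sup>2)"
      using infsum_le_finite_sums[OF sq main[OF f]] by (simp add: power_mult_distrib)
    then have "l2norm V (apply_kernel V K f) \<le> sqrt ((2 * C)\<^sup>2 * (\<Sum>\<^sub>\<infinity>x\<in>V. (cmod (f x))\<^sup>2))"
      unfolding l2norm_def by (rule real_sqrt_le_mono)
    then show "l2norm V (apply_kernel V K f) \<le> 2 * C * l2norm V f"
      using C by (simp add: l2norm_def real_sqrt_mult)
  qed
qed

lemma finite_support_l2:
  assumes "finite F" "F \<subseteq> V"
  shows "(\<lambda>x. if x \<in> F then f x else 0) \<in> l2 V"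
    and "(l2norm V (\<lambda>x. if x \<in> F then f x else 0))\<^sup>2 = sq_sum F f"
    and "apply_kernel V K (\<lambda>x. if x \<in> F then f x else 0) y = (\<Sum>x\<in>F. f x * K y x)"
proof -
  let ?f = "\<lambda>x. if x \<in> F then f x else 0"
  have hs: "((\<lambda>x. (cmod (?f x))\<^sup>2) has_sum sq_sum F f) V"
    using assms has_sum_finite[of F "\<lambda>x. (cmod (f x))\<^sup>2"]
    by (subst has_sum_cong_neutral[where T = F and g = "\<lambda>x. (cmod (f x))\<^sup>2"]) auto
  then show "?f \<in> l2 V" unfolding l2_def using has_sum_imp_summable by blast
  show "(l2norm V ?f)\<^sup>2 = sq_sum F f"
    unfolding l2norm_def infsumI[OF hs] by (simp add: sum_nonneg)
  have "((\<lambda>x. K y x * ?f x) has_sum (\<Sum>x\<in>F. f x * K y x)) V"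
    using assms has_sum_finite[of F "\<lambda>x. f x * K y x"]
    by (subst has_sum_cong_neutral[where T = F and g = "\<lambda>x. f x * K y x"]) auto
  then show "apply_kernel V K ?f y = (\<Sum>x\<in>F. f x * K y x)"
    unfolding apply_kernel_def by (rule infsumI)
qed

text \<open>Only the diagonal of the form is estimated, since squares of polynomials lead to nothing
  else. The constant 1 + C^2 comes from a b \<le> a^2 + b^2 and is insensitive to the sign of
  \<open>C\<close>.\<close>

lemma bounded_kernel_form:
  fixes K :: "'a \<Rightarrow> 'a \<Rightarrow> complex"
  assumes "bounded_kernel V K"
  obtains C where "\<And>F h. finite F \<Longrightarrow> F \<subseteq> V \<Longrightarrow>
    cmod (\<Sum>y\<in>F. cnj (h y) * (\<Sum>x\<in>F. h x * K y x)) \<le> C * sq_sum F h"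
proof -
  obtain C where C: "\<And>f. f \<in> l2 V \<Longrightarrow> apply_kernel V K f \<in> l2 V \<and>
      l2norm V (apply_kernel V K f) \<le> C * l2norm V f"
    using assms unfolding bounded_kernel_def by blast
  show ?thesis
  proof (rule that[of "1 + C\<^sup>2"])
    fix F and h :: "'a \<Rightarrow> complex" assume F: "finite F" "F \<subseteq> V"
    define f where "f x = (if x \<in> F then h x else 0)" for x
    define u where "u y = (\<Sum>x\<in>F. h x * K y x)" for y
    note fs = finite_support_l2[OF F, where f = h, folded f_def]
    have u: "apply_kernel V K f = u" using fs(3) by (auto simp: u_def)
    have "sq_sum F u \<le> (\<Sum>\<^sub>\<infinity>x\<in>V. (cmod (u x))\<^sup>2)"
      using C[OF fs(1)] F unfolding u by (intro finite_sum_le_infsum) (auto simp: l2_def)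
    also have "\<dots> = (l2norm V u)\<^sup>2" by (simp add: l2norm_def infsum_nonneg)
    also have "\<dots> \<le> (C * l2norm V f)\<^sup>2"
      using C[OF fs(1)] unfolding u by (intro power_mono) (auto simp: l2norm_def infsum_nonneg)
    also have "\<dots> = C\<^sup>2 * sq_sum F h" by (simp add: power_mult_distrib fs(2))
    finally have uC: "sq_sum F u \<le> C\<^sup>2 * sq_sum F h" .
    have "cmod (\<Sum>y\<in>F. cnj (h y) * u y) \<le> (\<Sum>y\<in>F. cmod (cnj (h y) * u y))" by (rule norm_sum)
    also have "\<dots> \<le> (\<Sum>y\<in>F. (cmod (h y))\<^sup>2 + (cmod (u y))\<^sup>2)"
    proof (rule sum_mono)
      fix y
      have "0 \<le> (cmod (h y) - cmod (u y))\<^sup>2 + (cmod (h y))\<^sup>2 + (cmod (u y))\<^sup>2" by simp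
      then show "cmod (cnj (h y) * u y) \<le> (cmod (h y))\<^sup>2 + (cmod (u y))\<^sup>2"
        by (simp add: norm_mult power2_diff)
    qed
    also have "\<dots> \<le> (1 + C\<^sup>2) * sq_sum F h" using uC by (simp add: sum.distrib algebra_simps)
    finally show "cmod (\<Sum>y\<in>F. cnj (h y) * (\<Sum>x\<in>F. h x * K y x)) \<le> (1 + C\<^sup>2) * sq_sum F h"
      by (simp add: u_def)
  qed
qed

lemma bounded_kernel_column:
  assumes "bounded_kernel V K" "x \<in> V"
  shows "(\<lambda>y. (cmod (K y x))\<^sup>2) summable_on V"
proof -
  have "apply_kernel V K (\<lambda>z. if z \<in> {x} then 1 else 0) \<in> l2 V"
    using assms finite_support_l2(1)[of "{x}" V "\<lambda>_. 1"] unfolding bounded_kernel_def by blast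
  moreover have "apply_kernel V K (\<lambda>z. if z \<in> {x} then 1 else 0) = (\<lambda>y. K y x)"
    using assms(2) finite_support_l2(3)[of "{x}" V K "\<lambda>_. 1"] by auto
  ultimately show ?thesis by (simp add: l2_def)
qed

section \<open>Radial forms\<close>

text \<open>\<open>f\<close> may be nonzero outside \<open>F\<close>; the support is cut off by the
  summation, and enlarging the set requires the explicit truncation in
  \<open>radial_comb_extend\<close>.\<close>

definition radial_comb :: "nat \<Rightarrow> nat list set \<Rightarrow> (nat list \<Rightarrow> complex) \<Rightarrow> nat list \<Rightarrow> real \<Rightarrow> complex" where
  "radial_comb k F f y t = (\<Sum>x\<in>F. f x * of_real (CD k (tree_dist k x y) t))"

definition radial_form ::
  "nat \<Rightarrow> nat list set \<Rightarrow> (nat list \<Rightarrow> complex) \<Rightarrow> (nat list \<Rightarrow> complex) \<Rightarrow> real \<Rightarrow> complex" where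
  "radial_form k F f g t = (\<Sum>y\<in>F. cnj (g y) * radial_comb k F f y t)"

lemma continuous_on_radial_comb: "continuous_on S (radial_comb k F f y)"
  unfolding radial_comb_def by (intro continuous_intros continuous_on_CD)

lemma continuous_on_radial_form: "continuous_on S (radial_form k F f g)"
  unfolding radial_form_def by (intro continuous_intros continuous_on_radial_comb)

lemma radial_comb_extend:
  "finite G \<Longrightarrow> F \<subseteq> G \<Longrightarrow> radial_comb k G (\<lambda>x. if x \<in> F then f x else 0) y t = radial_comb k F f y t"
  unfolding radial_comb_def by (intro sum.mono_neutral_cong_right) auto

text \<open>The eigenvalue equation moves the variable from the polynomials to the coefficients:
  each value \<open>f x\<close> is spread over the neighbours of \<open>x\<close>, and
  \<open>z\<close> collects what its neighbours in \<open>F\<close> send. The scalar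
  \<open>c\<close> is carried along because a linear polynomial function is a multiple of the
  identity.\<close>

lemma radial_comb_times_id:
  assumes k: "k \<ge> 1" and F: "finite F" "F \<subseteq> cayley_V k" and y: "y \<in> cayley_V k"
  shows "of_real (c * t) * radial_comb k F f y t =
    radial_comb k (\<Union>x\<in>F. nbrs k x) (\<lambda>z. \<Sum>x\<in>{x\<in>F. z \<in> nbrs k x}. f x * of_real (c / (real k + 1))) y t"
proof -
  let ?G = "\<Union>x\<in>F. nbrs k x" and ?c = "c / (real k + 1)"
  let ?P = "\<lambda>x. complex_of_real (CD k (tree_dist k x y) t)"
  have "of_real (c * t) * radial_comb k F f y t = (\<Sum>x\<in>F. of_real (c * t) * (f x * ?P x))"
    by (simp only: radial_comb_def sum_distrib_left)
  also have "\<dots> = (\<Sum>x\<in>F. f x * of_real ?c * (\<Sum>z\<in>nbrs k x. ?P z))"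
  proof (rule sum.cong[OF refl])
    fix x assume "x \<in> F"
    then have "(\<Sum>z\<in>nbrs k x. CD k (tree_dist k z y) t) = (real k + 1) * t * CD k (tree_dist k x y) t"
      using F y k by (intro sum_nbrs_CD) auto
    then have "(\<Sum>z\<in>nbrs k x. ?P z) = of_real ((real k + 1) * t * CD k (tree_dist k x y) t)"
      by (metis of_real_sum)
    moreover have "?c * ((real k + 1) * t * CD k (tree_dist k x y) t) = c * t * CD k (tree_dist k x y) t"
      by (simp add: field_simps)
    ultimately have "of_real ?c * (\<Sum>z\<in>nbrs k x. ?P z) = of_real (c * t) * ?P x"
      by (metis of_real_mult)
    then show "of_real (c * t) * (f x * ?P x) = f x * of_real ?c * (\<Sum>z\<in>nbrs k x. ?P z)"
      by (metis mult.assoc mult.left_commute)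
  qed
  also have "\<dots> = (\<Sum>x\<in>F. \<Sum>z\<in>{z\<in>?G. z \<in> nbrs k x}. f x * of_real ?c * ?P z)"
    unfolding sum_distrib_left by (intro sum.cong) auto
  also have "\<dots> = (\<Sum>z\<in>?G. \<Sum>x\<in>{x\<in>F. z \<in> nbrs k x}. f x * of_real ?c * ?P z)"
    using F by (intro sum.swap_restrict) auto
  also have "\<dots> = radial_comb k ?G (\<lambda>z. \<Sum>x\<in>{x\<in>F. z \<in> nbrs k x}. f x * of_real ?c) y t"
    by (simp add: radial_comb_def sum_distrib_right)
  finally show ?thesis .
qed

text \<open>The new coefficients depend neither on \<open>y\<close> nor on \<open>t\<close>. This
  uniformity is what allows the product to be integrated in \<open>t\<close> and used again as a
  form.\<close>

lemma radial_comb_times_poly: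
  assumes k: "k \<ge> 1" and p: "real_polynomial_function p" and F: "finite F" "F \<subseteq> cayley_V k"
  shows "\<exists>G h. finite G \<and> G \<subseteq> cayley_V k \<and>
    (\<forall>y\<in>cayley_V k. \<forall>t. of_real (p t) * radial_comb k F f y t = radial_comb k G h y t)"
  using p F
proof (induction p arbitrary: F f rule: real_polynomial_function.induct)
  case (linear p)
  then have p: "p t = p 1 * t" for t
    using linear_simps(5)[of p t 1] by (simp add: mult.commute)
  show ?case
  proof (intro exI conjI ballI allI)
    fix y t assume "y \<in> cayley_V k"
    then show "of_real (p t) * radial_comb k F f y t = radial_comb k (\<Union>x\<in>F. nbrs k x)
       (\<lambda>z. \<Sum>x\<in>{x\<in>F. z \<in> nbrs k x}. f x * of_real (p 1 / (real k + 1))) y t"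
      using p[of t] radial_comb_times_id[OF k linear(2,3), of y "p 1" t f] by simp
  qed (use linear nbrs_subset in auto)
next
  case (const c)
  have "of_real c * radial_comb k F f y t = radial_comb k F (\<lambda>x. of_real c * f x) y t" for y t
    by (simp add: radial_comb_def sum_distrib_left mult.assoc)
  then show ?case using const by blast
next
  case (add p q)
  obtain G h where G: "finite G" "G \<subseteq> cayley_V k"
    "\<forall>y\<in>cayley_V k. \<forall>t. of_real (p t) * radial_comb k F f y t = radial_comb k G h y t"
    using add.IH(1)[OF add.prems, of f] by auto
  obtain H l where H: "finite H" "H \<subseteq> cayley_V k"
    "\<forall>y\<in>cayley_V k. \<forall>t. of_real (q t) * radial_comb k F f y t = radial_comb k H l y t"
    using add.IH(2)[OF add.prems, of f] by auto
  let ?h = "\<lambda>x. (if x \<in> G then h x else 0) + (if x \<in> H then l x else 0)"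
  have "of_real (p t + q t) * radial_comb k F f y t = radial_comb k (G \<union> H) ?h y t"
    if "y \<in> cayley_V k" for y t
  proof -
    have "radial_comb k (G \<union> H) ?h y t = radial_comb k (G \<union> H) (\<lambda>x. if x \<in> G then h x else 0) y t +
       radial_comb k (G \<union> H) (\<lambda>x. if x \<in> H then l x else 0) y t"
      unfolding radial_comb_def by (simp only: distrib_right sum.distrib)
    also have "\<dots> = radial_comb k G h y t + radial_comb k H l y t"
      using G H by (subst (1 2) radial_comb_extend) auto
    finally show ?thesis using G(3) H(3) that by (simp add: distrib_right)
  qed
  then show ?case using G H by (intro exI[of _ "G \<union> H"] exI[of _ ?h]) auto
next
  case (mult p q)
  obtain G h where G: "finite G" "G \<subseteq> cayley_V k"
    "\<forall>y\<in>cayley_V k. \<forall>t. of_real (q t) * radial_comb k F f y t = radial_comb k G h y t"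
    using mult.IH(2)[OF mult.prems, of f] by auto
  obtain H l where H: "finite H" "H \<subseteq> cayley_V k"
    "\<forall>y\<in>cayley_V k. \<forall>t. of_real (p t) * radial_comb k G h y t = radial_comb k H l y t"
    using mult.IH(1)[OF G(1,2), of h] by auto
  show ?case using G H by (intro exI[of _ H] exI[of _ l]) (auto simp: mult.assoc)
qed

lemma sum_radial_comb_swap:
  assumes "F \<subseteq> cayley_V k" "G \<subseteq> cayley_V k"
  shows "(\<Sum>y\<in>F. cnj (f y) * radial_comb k G h y t) = cnj (\<Sum>z\<in>G. cnj (h z) * radial_comb k F f z t)"
proof -
  have "(\<Sum>y\<in>F. cnj (f y) * radial_comb k G h y t) =
      (\<Sum>y\<in>F. \<Sum>z\<in>G. cnj (f y) * (h z * of_real (CD k (tree_dist k z y) t)))"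
    by (simp add: radial_comb_def sum_distrib_left)
  also have "\<dots> = (\<Sum>z\<in>G. \<Sum>y\<in>F. cnj (f y) * (h z * of_real (CD k (tree_dist k z y) t)))"
    by (rule sum.swap)
  also have "\<dots> = (\<Sum>z\<in>G. \<Sum>y\<in>F. h z * (cnj (f y) * of_real (CD k (tree_dist k y z) t)))"
  proof (intro sum.cong refl)
    fix z y assume "z \<in> G" "y \<in> F"
    then have "tree_dist k z y = tree_dist k y z" using assms tree_dist_sym by blast
    then show "cnj (f y) * (h z * of_real (CD k (tree_dist k z y) t)) =
      h z * (cnj (f y) * of_real (CD k (tree_dist k y z) t))" by simp
  qed
  finally show ?thesis by (simp add: radial_comb_def sum_distrib_left)
qed

lemma radial_form_swap:
  "F \<subseteq> cayley_V k \<Longrightarrow> cnj (radial_form k F f g t) = radial_form k F g f t"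
  using sum_radial_comb_swap[of F k F g f t] by (simp add: radial_form_def)

text \<open>One factor \<open>a\<close> is absorbed in the first argument; after exchanging the
  arguments by hermitian symmetry the second factor is absorbed in the other one. The square is thus
  shared between the two sides.\<close>

lemma radial_form_times_poly_sq:
  assumes F: "F \<subseteq> cayley_V k" and G: "G \<subseteq> cayley_V k"
    and h: "\<And>y. y \<in> cayley_V k \<Longrightarrow> of_real a * radial_comb k F f y t = radial_comb k G h y t"
  shows "of_real (a\<^sup>2) * radial_form k F f f t = radial_form k G h h t"
proof -
  have "of_real (a\<^sup>2) * radial_form k F f f t =
      of_real a * (\<Sum>y\<in>F. cnj (f y) * (of_real a * radial_comb k F f y t))"
    by (simp add: radial_form_def sum_distrib_left power2_eq_square mult_ac)
  also have "(\<Sum>y\<in>F. cnj (f y) * (of_real a * radial_comb k F f y t)) =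
      (\<Sum>y\<in>F. cnj (f y) * radial_comb k G h y t)"
    using F h by (intro sum.cong refl) (metis subsetD)
  also have "\<dots> = cnj (\<Sum>z\<in>G. cnj (h z) * radial_comb k F f z t)"
    by (rule sum_radial_comb_swap[OF F G])
  also have "of_real a * \<dots> = cnj (\<Sum>z\<in>G. cnj (h z) * (of_real a * radial_comb k F f z t))"
    by (simp add: sum_distrib_left mult_ac)
  also have "(\<Sum>z\<in>G. cnj (h z) * (of_real a * radial_comb k F f z t)) = radial_form k G h h t"
    unfolding radial_form_def using G h by (intro sum.cong refl) (metis subsetD)
  finally show ?thesis using radial_form_swap[OF G] by simp
qed

lemma CD_AE_bounded: "\<exists>B. AE t in Pi_meas k. cmod (of_real (CD k n t)) \<le> B"
proof -
  have "compact (CD k n ` {-1..1})"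
    by (intro compact_continuous_image continuous_on_CD) auto
  then obtain B where B: "\<And>t. t \<in> {-1..1} \<Longrightarrow> \<bar>CD k n t\<bar> \<le> B"
    by (metis bounded_iff compact_imp_bounded imageI real_norm_def)
  have "AE t in Pi_meas k. cmod (of_real (CD k n t)) \<le> B"
    using AE_Pi_abs_le_1 by eventually_elim (auto intro!: B)
  then show ?thesis ..
qed

lemma integrable_CD_mult:
  fixes \<phi> :: "real \<Rightarrow> complex"
  assumes "integrable (Pi_meas k) \<phi>"
  shows "integrable (Pi_meas k) (\<lambda>t. of_real (CD k n t) * \<phi> t)"
proof -
  obtain B where "AE t in Pi_meas k. cmod (of_real (CD k n t)) \<le> B" using CD_AE_bounded by blast
  then show ?thesis by (intro integrable_bounded_mult[OF assms]) auto
qed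

lemma integrable_radial_form_mult:
  fixes \<phi> :: "real \<Rightarrow> complex"
  assumes \<phi>: "integrable (Pi_meas k) \<phi>"
  shows "integrable (Pi_meas k) (\<lambda>t. radial_form k F f g t * \<phi> t)"
    and "(\<integral>t. radial_form k F f g t * \<phi> t \<partial>Pi_meas k) =
      (\<Sum>y\<in>F. cnj (g y) * (\<Sum>x\<in>F. f x * fhat k \<phi> (tree_dist k x y)))"
proof -
  have eq: "radial_form k F f g t * \<phi> t =
      (\<Sum>y\<in>F. cnj (g y) * (\<Sum>x\<in>F. f x * (of_real (CD k (tree_dist k x y) t) * \<phi> t)))" for t
    by (simp add: radial_form_def radial_comb_def sum_distrib_left sum_distrib_right mult.assoc)
  note int = integrable_CD_mult[OF \<phi>]
  have int': "integrable (Pi_meas k) (\<lambda>t. \<Sum>x\<in>F. f x * (of_real (CD k (tree_dist k x y) t) * \<phi> t))" for y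
    by (intro Bochner_Integration.integrable_sum integrable_mult_right int)
  show "integrable (Pi_meas k) (\<lambda>t. radial_form k F f g t * \<phi> t)"
    unfolding eq by (intro Bochner_Integration.integrable_sum integrable_mult_right int')
  have inner: "(\<integral>t. (\<Sum>x\<in>F. f x * (of_real (CD k (tree_dist k x y) t) * \<phi> t)) \<partial>Pi_meas k) =
      (\<Sum>x\<in>F. f x * fhat k \<phi> (tree_dist k x y))" for y
    by (subst Bochner_Integration.integral_sum) (auto intro: int integrable_mult_right simp: fhat_def)
  have "(\<integral>t. radial_form k F f g t * \<phi> t \<partial>Pi_meas k) =
      (\<Sum>y\<in>F. \<integral>t. cnj (g y) * (\<Sum>x\<in>F. f x * (of_real (CD k (tree_dist k x y) t) * \<phi> t)) \<partial>Pi_meas k)"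
    unfolding eq by (intro Bochner_Integration.integral_sum integrable_mult_right int')
  also have "\<dots> = (\<Sum>y\<in>F. cnj (g y) * (\<Sum>x\<in>F. f x * fhat k \<phi> (tree_dist k x y)))"
    by (simp only: integral_mult_right_zero inner)
  finally show "(\<integral>t. radial_form k F f g t * \<phi> t \<partial>Pi_meas k) =
      (\<Sum>y\<in>F. cnj (g y) * (\<Sum>x\<in>F. f x * fhat k \<phi> (tree_dist k x y)))" .
qed

lemma Pi_integrable_const: "integrable (Pi_meas k) (\<lambda>t. c :: complex)"
  using finite_measure.integrable_const[OF finite_measure_Pi] by blast

lemma fhat_1: "k \<ge> 1 \<Longrightarrow> fhat k (\<lambda>_. 1) n = (if n = 0 then 1 else 0)"
  using Pi_integral_CD[of k n] by (simp add: fhat_def)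

lemma integral_radial_form:
  assumes k: "k \<ge> 1" and F: "finite F" "F \<subseteq> cayley_V k"
  shows "(\<integral>t. radial_form k F f f t \<partial>Pi_meas k) = of_real (sq_sum F f)"
proof -
  have "(\<integral>t. radial_form k F f f t \<partial>Pi_meas k) =
      (\<Sum>y\<in>F. cnj (f y) * (\<Sum>x\<in>F. f x * fhat k (\<lambda>_. 1) (tree_dist k x y)))"
    using integrable_radial_form_mult(2)[OF Pi_integrable_const, of k F f f 1] by simp
  also have "\<dots> = (\<Sum>y\<in>F. cnj (f y) * f y)"
  proof (rule sum.cong[OF refl])
    fix y assume y: "y \<in> F"
    have "(\<Sum>x\<in>F. f x * fhat k (\<lambda>_. 1) (tree_dist k x y)) = (\<Sum>x\<in>F. if x = y then f x else 0)"
    proof (intro sum.cong refl)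
      fix x assume "x \<in> F"
      then have "tree_dist k x y = 0 \<longleftrightarrow> x = y" using F y by (intro tree_dist_eq_0_iff) auto
      then show "f x * fhat k (\<lambda>_. 1) (tree_dist k x y) = (if x = y then f x else 0)"
        by (simp add: fhat_1[OF k])
    qed
    then show "cnj (f y) * (\<Sum>x\<in>F. f x * fhat k (\<lambda>_. 1) (tree_dist k x y)) = cnj (f y) * f y"
      using F y by simp
  qed
  finally show ?thesis by (simp only: cnj_mult_self of_real_sum)
qed

text \<open>The kernels \<open>CD k (tree_dist k x y) t\<close> are positive definite for almost every \<open>t\<close>: multiplying
  the form by the square of a polynomial gives a form of the same kind, whose integral is a sum of
  squares.\<close>

lemma radial_form_nonneg:
  assumes k: "k \<ge> 1" and F: "finite F" "F \<subseteq> cayley_V k"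
  shows "AE t in Pi_meas k. 0 \<le> Re (radial_form k F f f t)"
proof (rule AE_nonneg_if_poly_nonneg)
  show "integrable (Pi_meas k) (\<lambda>t. Re (radial_form k F f f t))"
    by (intro Pi_integrable_continuous continuous_intros continuous_on_radial_form)
  fix p :: "real \<Rightarrow> real" assume p: "real_polynomial_function p"
  obtain G h where G: "finite G" "G \<subseteq> cayley_V k"
    "\<forall>y\<in>cayley_V k. \<forall>t. of_real (p t) * radial_comb k F f y t = radial_comb k G h y t"
    using radial_comb_times_poly[OF k p F, of f] by blast
  have "Re (radial_form k F f f t) * (p t)\<^sup>2 = Re (radial_form k G h h t)" for t
  proof -
    have "radial_form k G h h t = of_real ((p t)\<^sup>2) * radial_form k F f f t"
      using F G by (intro radial_form_times_poly_sq[symmetric]) auto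
    then show ?thesis by (simp del: of_real_power)
  qed
  then have "(\<integral>t. Re (radial_form k F f f t) * (p t)\<^sup>2 \<partial>Pi_meas k) = (\<integral>t. Re (radial_form k G h h t) \<partial>Pi_meas k)"
    by simp
  also have "\<dots> = Re (\<integral>t. radial_form k G h h t \<partial>Pi_meas k)"
    by (intro integral_Re Pi_integrable_continuous continuous_on_radial_form)
  also have "\<dots> = sq_sum G h" using integral_radial_form[OF k G(1,2)] by simp
  also have "\<dots> \<ge> 0" by (simp add: sum_nonneg)
  finally show "0 \<le> (\<integral>t. Re (radial_form k F f f t) * (p t)\<^sup>2 \<partial>Pi_meas k)" .
qed (auto simp: AE_Pi_abs_le_1)

text \<open>Positivity of the form at \<open>f + c g\<close> for c = 1, -1 bounds twice the modulus
  of the real part by the right-hand side; c = i, -i does so for the imaginary part. Finitely many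
  directions keep the exceptional set null.\<close>

lemma radial_form_bound:
  assumes k: "k \<ge> 1" and F: "finite F" "F \<subseteq> cayley_V k"
  shows "AE t in Pi_meas k. cmod (radial_form k F f g t) \<le>
    Re (radial_form k F f f t) + Re (radial_form k F g g t)"
proof -
  have expand: "Re (radial_form k F (\<lambda>x. f x + c * g x) (\<lambda>x. f x + c * g x) t) =
      Re (radial_form k F f f t) + 2 * Re (cnj c * radial_form k F f g t) + (cmod c)\<^sup>2 * Re (radial_form k F g g t)"
    for c t
  proof -
    have "radial_form k F (\<lambda>x. f x + c * g x) (\<lambda>x. f x + c * g x) t =
      radial_form k F f f t + cnj c * radial_form k F f g t + c * radial_form k F g f t +
      (c * cnj c) * radial_form k F g g t"
      by (simp add: radial_form_def radial_comb_def sum_distrib_left sum.distrib algebra_simps)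
    moreover have "radial_form k F g f t = cnj (radial_form k F f g t)"
      using radial_form_swap[OF F(2)] by metis
    moreover have "c * cnj c = of_real ((cmod c)\<^sup>2)" by (rule complex_norm_square[symmetric])
    ultimately show ?thesis by (simp add: algebra_simps del: of_real_power)
  qed
  have "AE t in Pi_meas k. \<forall>c\<in>{1, -1, \<i>, -\<i>}. 0 \<le> Re (radial_form k F (\<lambda>x. f x + c * g x) (\<lambda>x. f x + c * g x) t)"
    by (intro AE_finite_allI radial_form_nonneg[OF k F]) auto
  then show ?thesis
  proof eventually_elim
    case (elim t)
    have "0 \<le> Re (radial_form k F f f t) + 2 * Re (cnj c * radial_form k F f g t) + (cmod c)\<^sup>2 * Re (radial_form k F g g t)"
      if "c \<in> {1, -1, \<i>, -\<i>}" for c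
      using elim that unfolding expand by blast
    from this[of 1] this[of "-1"] this[of \<i>] this[of "-\<i>"]
    show ?case using cmod_le[of "radial_form k F f g t"] by (simp add: abs_if split: if_splits)
  qed
qed

section \<open>The coefficient map\<close>

lemma Linf_integrable:
  assumes "\<phi> \<in> Linf k" shows "integrable (Pi_meas k) \<phi>"
proof -
  interpret finite_measure "Pi_meas k" by (rule finite_measure_Pi)
  show ?thesis using assms integrable_const_bound unfolding Linf_def by blast
qed

text \<open>The form of the point mass at the root is identically 1, so the square of
  \<open>p\<close> is itself a radial form. Integrating it against \<open>\<phi>\<close> gives a
  quadratic form of the kernel with coefficients \<open>fhat k \<phi>\<close>.\<close>

lemma integral_poly_sq:
  assumes k: "k \<ge> 1" and p: "real_polynomial_function p" and \<phi>: "integrable (Pi_meas k) \<phi>"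
  obtains G h where "finite G" "G \<subseteq> cayley_V k"
    "(\<integral>t. of_real ((p t)\<^sup>2) * \<phi> t \<partial>Pi_meas k) =
       (\<Sum>y\<in>G. cnj (h y) * (\<Sum>x\<in>G. h x * fhat k \<phi> (tree_dist k x y)))"
    "(\<integral>t. (p t)\<^sup>2 \<partial>Pi_meas k) = sq_sum G h"
proof -
  have F: "finite {[]}" "{[]} \<subseteq> cayley_V k" by (auto simp: Nil_in_cayley_V)
  obtain G h where G: "finite G" "G \<subseteq> cayley_V k"
    "\<forall>y\<in>cayley_V k. \<forall>t. of_real (p t) * radial_comb k {[]} (\<lambda>_. 1) y t = radial_comb k G h y t"
    using radial_comb_times_poly[OF k p F, of "\<lambda>_. 1"] by blast
  have one: "radial_form k {[]} (\<lambda>_. 1) (\<lambda>_. 1) t = 1" for t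
    using tree_dist_eq_0_iff[OF Nil_in_cayley_V Nil_in_cayley_V, of k]
    by (simp add: radial_form_def radial_comb_def)
  have eq: "of_real ((p t)\<^sup>2) = radial_form k G h h t" for t
    using radial_form_times_poly_sq[OF F(2) G(2), of "p t" "\<lambda>_. 1" t h] G(3) one[of t] by simp
  show ?thesis
  proof (rule that[OF G(1,2)])
    show "(\<integral>t. of_real ((p t)\<^sup>2) * \<phi> t \<partial>Pi_meas k) =
       (\<Sum>y\<in>G. cnj (h y) * (\<Sum>x\<in>G. h x * fhat k \<phi> (tree_dist k x y)))"
      unfolding eq using integrable_radial_form_mult(2)[OF \<phi>] .
    have "complex_of_real (\<integral>t. (p t)\<^sup>2 \<partial>Pi_meas k) = (\<integral>t. complex_of_real ((p t)\<^sup>2) \<partial>Pi_meas k)"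
      by (rule integral_complex_of_real[symmetric])
    also have "\<dots> = of_real (sq_sum G h)"
      unfolding eq by (rule integral_radial_form[OF k G(1,2)])
    finally show "(\<integral>t. (p t)\<^sup>2 \<partial>Pi_meas k) = sq_sum G h" by (simp only: of_real_eq_iff)
  qed
qed

lemma continuous_on_real_poly: "real_polynomial_function p \<Longrightarrow> continuous_on S p"
  by (simp add: continuous_on_polymonial_function real_polynomial_function_eq)

text \<open>The real functions C - Re (c \<open>\<phi>\<close>) are nonnegative against squares for
  c = 1, -1, i, -i. Hence real and imaginary parts are bounded by \<open>C\<close>, and the modulus
  by twice that.\<close>

lemma AE_bounded_if_poly_bounded:
  fixes \<phi> :: "real \<Rightarrow> complex"
  assumes \<phi>: "integrable (Pi_meas k) \<phi>"
    and bd: "\<And>p. real_polynomial_function p \<Longrightarrow>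
      cmod (\<integral>t. of_real ((p t)\<^sup>2) * \<phi> t \<partial>Pi_meas k) \<le> C * (\<integral>t. (p t)\<^sup>2 \<partial>Pi_meas k)"
  shows "AE t in Pi_meas k. cmod (\<phi> t) \<le> 2 * C"
proof -
  interpret finite_measure "Pi_meas k" by (rule finite_measure_Pi)
  have dir: "AE t in Pi_meas k. 0 \<le> C - Re (c * \<phi> t)" if c: "cmod c = 1" for c
  proof (rule AE_nonneg_if_poly_nonneg)
    show "integrable (Pi_meas k) (\<lambda>t. C - Re (c * \<phi> t))"
      using \<phi> by (intro Bochner_Integration.integrable_diff integrable_Re integrable_mult_right integrable_const)
    fix p :: "real \<Rightarrow> real" assume p: "real_polynomial_function p"
    have cp: "continuous_on UNIV (\<lambda>t. (p t)\<^sup>2)"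
      using continuous_on_real_poly[OF p] by (intro continuous_intros)
    then have ip: "integrable (Pi_meas k) (\<lambda>t. (p t)\<^sup>2)" by (rule Pi_integrable_continuous)
    have i2: "integrable (Pi_meas k) (\<lambda>t. of_real ((p t)\<^sup>2) * \<phi> t)"
    proof -
      have "compact ((\<lambda>t. (p t)\<^sup>2) ` {-1..1})"
        using cp by (intro compact_continuous_image) (auto intro: continuous_on_subset)
      then obtain B where B: "\<And>t. t \<in> {-1..1} \<Longrightarrow> \<bar>(p t)\<^sup>2\<bar> \<le> B"
        by (metis bounded_iff compact_imp_bounded imageI real_norm_def)
      have "AE t in Pi_meas k. cmod (of_real ((p t)\<^sup>2)) \<le> B"
        using AE_Pi_abs_le_1 
      proof eventually_elim
        fix t :: real assume "\<bar>t\<bar> \<le> 1"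
        then have "t \<in> {-1..1}" by auto
        then show "cmod (of_real ((p t)\<^sup>2)) \<le> B" using B by (simp add: norm_power)
      qed
      moreover have "p \<in> borel_measurable borel"
        by (rule borel_measurable_continuous_onI[OF continuous_on_real_poly[OF p]])
      ultimately show ?thesis by (intro integrable_bounded_mult[OF \<phi>]) auto
    qed
    have "(\<integral>t. (C - Re (c * \<phi> t)) * (p t)\<^sup>2 \<partial>Pi_meas k) =
        (\<integral>t. C * (p t)\<^sup>2 - Re (c * (of_real ((p t)\<^sup>2) * \<phi> t)) \<partial>Pi_meas k)"
      by (intro Bochner_Integration.integral_cong refl) (simp add: algebra_simps del: of_real_power)
    also have "\<dots> = C * (\<integral>t. (p t)\<^sup>2 \<partial>Pi_meas k) - Re (c * (\<integral>t. of_real ((p t)\<^sup>2) * \<phi> t \<partial>Pi_meas k))"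
      using ip i2 by (simp only: Bochner_Integration.integral_diff integrable_mult_right integrable_Re
          integral_mult_right_zero integral_Re)
    also have "\<dots> \<ge> 0"
      using bd[OF p] complex_Re_le_cmod[of "c * (\<integral>t. of_real ((p t)\<^sup>2) * \<phi> t \<partial>Pi_meas k)"] c
      by (simp add: norm_mult)
    finally show "0 \<le> (\<integral>t. (C - Re (c * \<phi> t)) * (p t)\<^sup>2 \<partial>Pi_meas k)" .
  qed (auto simp: AE_Pi_abs_le_1)
  have "AE t in Pi_meas k. \<forall>c\<in>{1, -1, \<i>, -\<i>}. 0 \<le> C - Re (c * \<phi> t)"
    by (intro AE_finite_allI dir) auto
  then show ?thesis
  proof eventually_elim
    case (elim t)
    then show ?case using cmod_le[of "\<phi> t"] by (simp add: abs_if split: if_splits)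
  qed
qed

lemma fhat_eq_imp_AE_eq:
  assumes k: "k \<ge> 1" and \<phi>: "integrable (Pi_meas k) \<phi>" and \<psi>: "integrable (Pi_meas k) \<psi>"
    and eq: "\<And>n. fhat k \<phi> n = fhat k \<psi> n"
  shows "AE t in Pi_meas k. \<phi> t = \<psi> t"
proof -
  have int: "integrable (Pi_meas k) (\<lambda>t. \<phi> t - \<psi> t)" using \<phi> \<psi> by simp
  have 0: "fhat k (\<lambda>t. \<phi> t - \<psi> t) n = 0" for n
    using eq[of n] integrable_CD_mult[OF \<phi>] integrable_CD_mult[OF \<psi>]
    by (simp add: fhat_def right_diff_distrib)
  have "AE t in Pi_meas k. cmod (\<phi> t - \<psi> t) \<le> 2 * 0"
  proof (rule AE_bounded_if_poly_bounded[OF int])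
    fix p :: "real \<Rightarrow> real" assume p: "real_polynomial_function p"
    show "cmod (\<integral>t. of_real ((p t)\<^sup>2) * (\<phi> t - \<psi> t) \<partial>Pi_meas k) \<le> 0 * (\<integral>t. (p t)\<^sup>2 \<partial>Pi_meas k)"
      by (rule integral_poly_sq[OF k p int]) (simp add: 0 del: of_real_power)
  qed
  then show ?thesis by eventually_elim simp
qed

lemma Tphi_in_B_Gamma:
  assumes k: "k \<ge> 1" and \<phi>: "\<phi> \<in> Linf k"
  shows "Tphi k \<phi> \<in> B_Gamma k"
proof -
  obtain C where C: "AE t in Pi_meas k. cmod (\<phi> t) \<le> C" using \<phi> by (auto simp: Linf_def)
  note int = Linf_integrable[OF \<phi>]
  have "bounded_kernel (cayley_V k) (Tphi k \<phi>)"
  \<comment> \<open>A positive bound whatever the value of \<open>C\<close>.\<close>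
  proof (rule bounded_kernelI[of "\<bar>C\<bar> + 1"])
    fix F f g assume F: "finite F" "F \<subseteq> cayley_V k"
    let ?R = "\<lambda>f t. Re (radial_form k F f f t)"
    have Ri: "integrable (Pi_meas k) (?R f)" for f
      by (intro Pi_integrable_continuous continuous_intros continuous_on_radial_form)
    have RI: "(\<integral>t. ?R f t \<partial>Pi_meas k) = sq_sum F f" for f
    proof -
      have "(\<integral>t. ?R f t \<partial>Pi_meas k) = Re (\<integral>t. radial_form k F f f t \<partial>Pi_meas k)"
        by (intro integral_Re Pi_integrable_continuous continuous_on_radial_form)
      then show ?thesis using integral_radial_form[OF k F] by simp
    qed
    have "(\<Sum>y\<in>F. cnj (g y) * (\<Sum>x\<in>F. f x * Tphi k \<phi> y x)) =
        (\<Sum>y\<in>F. cnj (g y) * (\<Sum>x\<in>F. f x * fhat k \<phi> (tree_dist k x y)))"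
    proof (intro sum.cong refl arg_cong2[of _ _ _ _ "(*)"])
      fix x y assume "x \<in> F" "y \<in> F"
      then have "tree_dist k y x = tree_dist k x y" using F tree_dist_sym by blast
      then show "Tphi k \<phi> y x = fhat k \<phi> (tree_dist k x y)" by (simp add: Tphi_def T_alpha_def)
    qed
    also have "\<dots> = (\<integral>t. radial_form k F f g t * \<phi> t \<partial>Pi_meas k)"
      using integrable_radial_form_mult(2)[OF int] by simp
    finally have eq: "(\<Sum>y\<in>F. cnj (g y) * (\<Sum>x\<in>F. f x * Tphi k \<phi> y x)) =
        (\<integral>t. radial_form k F f g t * \<phi> t \<partial>Pi_meas k)" .
    have "cmod (\<integral>t. radial_form k F f g t * \<phi> t \<partial>Pi_meas k) \<le>
        (\<integral>t. cmod (radial_form k F f g t * \<phi> t) \<partial>Pi_meas k)"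
      by (rule integral_norm_bound)
    also have "\<dots> \<le> (\<integral>t. (\<bar>C\<bar> + 1) * (?R f t + ?R g t) \<partial>Pi_meas k)"
    proof (rule integral_mono_AE)
      show "integrable (Pi_meas k) (\<lambda>t. cmod (radial_form k F f g t * \<phi> t))"
        using integrable_radial_form_mult(1)[OF int] by (rule integrable_norm)
      show "integrable (Pi_meas k) (\<lambda>t. (\<bar>C\<bar> + 1) * (?R f t + ?R g t))"
        using Ri by (intro integrable_mult_right Bochner_Integration.integrable_add)
      show "AE t in Pi_meas k. cmod (radial_form k F f g t * \<phi> t) \<le> (\<bar>C\<bar> + 1) * (?R f t + ?R g t)"
        using C radial_form_bound[OF k F, of f g]
      proof eventually_elim
        fix t assume t: "cmod (\<phi> t) \<le> C" "cmod (radial_form k F f g t) \<le> ?R f t + ?R g t"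
        have "cmod (\<phi> t) * cmod (radial_form k F f g t) \<le> (\<bar>C\<bar> + 1) * (?R f t + ?R g t)"
          using t by (intro mult_mono) auto
        then show "cmod (radial_form k F f g t * \<phi> t) \<le> (\<bar>C\<bar> + 1) * (?R f t + ?R g t)"
          by (simp only: norm_mult mult.commute)
      qed
    qed
    also have "\<dots> = (\<bar>C\<bar> + 1) * (sq_sum F f + sq_sum F g)"
      using Ri by (simp add: RI)
    finally show "cmod (\<Sum>y\<in>F. cnj (g y) * (\<Sum>x\<in>F. f x * Tphi k \<phi> y x)) \<le>
        (\<bar>C\<bar> + 1) * (sq_sum F f + sq_sum F g)" unfolding eq .
  qed simp
  then show ?thesis unfolding B_Gamma_def Tphi_def by blast
qed

section \<open>Linearity and conjugation for the coefficients\<close>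

lemma fhat_add:
  assumes "integrable (Pi_meas k) \<phi>" "integrable (Pi_meas k) \<psi>"
  shows "fhat k (\<lambda>t. \<phi> t + \<psi> t) n = fhat k \<phi> n + fhat k \<psi> n"
  using integrable_CD_mult[OF assms(1)] integrable_CD_mult[OF assms(2)]
  by (simp add: fhat_def distrib_left)

lemma fhat_scale: "fhat k (\<lambda>t. c * \<phi> t) n = c * fhat k \<phi> n"
  by (simp add: fhat_def mult.left_commute)

lemma fhat_cnj: "fhat k (\<lambda>t. cnj (\<phi> t)) n = cnj (fhat k \<phi> n)"
  using Bochner_Integration.integral_cnj[of "Pi_meas k" "\<lambda>t. of_real (CD k n t) * \<phi> t"] by (simp add: fhat_def)

lemma fhat_cong_AE:
  assumes "\<phi> \<in> borel_measurable (Pi_meas k)" "\<psi> \<in> borel_measurable (Pi_meas k)"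
    and "AE t in Pi_meas k. \<phi> t = \<psi> t"
  shows "fhat k \<phi> n = fhat k \<psi> n"
  unfolding fhat_def using assms by (intro integral_cong_AE) auto

section \<open>Balls, Fourier partial sums and their limits\<close>

definition ball_at :: "nat \<Rightarrow> nat list \<Rightarrow> nat \<Rightarrow> nat list set" where
  "ball_at k x N = (\<Union>n<N. sphere_at k x n)"

lemma finite_ball_at: "x \<in> cayley_V k \<Longrightarrow> finite (ball_at k x N)"
  by (simp add: ball_at_def finite_sphere_at)

lemma ball_at_subset: "ball_at k x N \<subseteq> cayley_V k"
  by (auto simp: ball_at_def sphere_at_def)

lemma sum_ball_at:
  assumes "x \<in> cayley_V k"
  shows "sum F (ball_at k x N) = (\<Sum>n<N. sum F (sphere_at k x n))"
  unfolding ball_at_def using assms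
  by (intro sum.UNION_disjoint) (auto simp: finite_sphere_at, auto simp: sphere_at_def)

text \<open>Makes unconditional sums over all vertices limits of sums over balls. A ball contains
  the distances strictly below \<open>N\<close>, which matches partial sums over
  \<open>{..<N}\<close>.\<close>

lemma filterlim_ball_at:
  assumes "x \<in> cayley_V k"
  shows "filterlim (ball_at k x) (finite_subsets_at_top (cayley_V k)) sequentially"
  unfolding filterlim_finite_subsets_at_top
proof (intro allI impI)
  fix X assume X: "finite X \<and> X \<subseteq> cayley_V k"
  show "\<forall>\<^sub>F N in sequentially. finite (ball_at k x N) \<and> X \<subseteq> ball_at k x N \<and> ball_at k x N \<subseteq> cayley_V k"
    using eventually_gt_at_top[of "Max (insert 0 (tree_dist k x ` X))"]
  proof eventually_elim
    case (elim N)
    have "tree_dist k x z < N" if "z \<in> X" for z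
      using elim X that by (meson Max_ge finite_imageI finite_insert imageI insertI2 le_less_trans)
    then show ?case using X finite_ball_at[OF assms] ball_at_subset
      by (auto simp: ball_at_def sphere_at_def)
  qed
qed

text \<open>Grouping a square summable row by spheres gives the Parseval condition for the
  coefficient sequence.\<close>

lemma summable_sphere_sq:
  assumes k: "k \<ge> 1" and x: "x \<in> cayley_V k"
    and sm: "(\<lambda>z. (cmod (\<alpha> (tree_dist k x z)))\<^sup>2) summable_on cayley_V k"
  shows "summable (\<lambda>n. sphere_card k n * (cmod (\<alpha> n))\<^sup>2)"
proof (rule summableI_nonneg_bounded)
  show "0 \<le> sphere_card k n * (cmod (\<alpha> n))\<^sup>2" for n by (simp add: sphere_card_def)
  fix N
  have "(\<Sum>n<N. sphere_card k n * (cmod (\<alpha> n))\<^sup>2) = (\<Sum>n<N. \<Sum>z\<in>sphere_at k x n. (cmod (\<alpha> (tree_dist k x z)))\<^sup>2)"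
    by (intro sum.cong refl) (simp add: sphere_at_def flip: card_sphere_at[OF k x])
  also have "\<dots> = (\<Sum>z\<in>ball_at k x N. (cmod (\<alpha> (tree_dist k x z)))\<^sup>2)"
    by (rule sum_ball_at[OF x, symmetric])
  also have "\<dots> \<le> (\<Sum>\<^sub>\<infinity>z\<in>cayley_V k. (cmod (\<alpha> (tree_dist k x z)))\<^sup>2)"
    by (rule finite_sum_le_infsum[OF sm finite_ball_at[OF x] ball_at_subset]) simp
  finally show "(\<Sum>n<N. sphere_card k n * (cmod (\<alpha> n))\<^sup>2) \<le> (\<Sum>\<^sub>\<infinity>z\<in>cayley_V k. (cmod (\<alpha> (tree_dist k x z)))\<^sup>2)" .
qed

text \<open>Partial sums of the Fourier series with coefficients \<open>\<alpha>\<close>: by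
  \<open>CD_orthogonal\<close> the weight \<open>sphere_card k n\<close> is the reciprocal of the
  squared norm of \<open>CD k n\<close>.\<close>

definition CD_sum :: "nat \<Rightarrow> (nat \<Rightarrow> complex) \<Rightarrow> nat set \<Rightarrow> real \<Rightarrow> complex" where
  "CD_sum k \<alpha> I t = (\<Sum>n\<in>I. \<alpha> n * of_real (sphere_card k n * CD k n t))"

lemma continuous_on_CD_sum: "continuous_on S (CD_sum k \<alpha> I)"
  unfolding CD_sum_def by (intro continuous_intros continuous_on_CD)

lemma integral_CD_sum_sq:
  assumes k: "k \<ge> 1" and I: "finite I"
  shows "(\<integral>t. (cmod (CD_sum k \<alpha> I t))\<^sup>2 \<partial>Pi_meas k) = (\<Sum>n\<in>I. sphere_card k n * (cmod (\<alpha> n))\<^sup>2)"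
proof -
  let ?s = "sphere_card k"
  have "(cmod (CD_sum k \<alpha> I t))\<^sup>2 =
      (\<Sum>m\<in>I. \<Sum>n\<in>I. (?s m * ?s n * Re (\<alpha> m * cnj (\<alpha> n))) * (CD k m t * CD k n t))" for t
  proof -
    have "(cmod (CD_sum k \<alpha> I t))\<^sup>2 = Re (CD_sum k \<alpha> I t * cnj (CD_sum k \<alpha> I t))"
      by (simp only: complex_norm_square[symmetric] Re_complex_of_real)
    also have "\<dots> = Re (\<Sum>m\<in>I. \<Sum>n\<in>I. of_real (?s m * ?s n * (CD k m t * CD k n t)) * (\<alpha> m * cnj (\<alpha> n)))"
      by (simp add: CD_sum_def sum_product mult_ac)
    also have "\<dots> = (\<Sum>m\<in>I. \<Sum>n\<in>I. ?s m * ?s n * (CD k m t * CD k n t) * Re (\<alpha> m * cnj (\<alpha> n)))"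
      by (simp del: of_real_mult)
    finally show ?thesis by (simp only: mult_ac)
  qed
  then have "(\<integral>t. (cmod (CD_sum k \<alpha> I t))\<^sup>2 \<partial>Pi_meas k) =
      (\<integral>t. (\<Sum>m\<in>I. \<Sum>n\<in>I. (?s m * ?s n * Re (\<alpha> m * cnj (\<alpha> n))) * (CD k m t * CD k n t)) \<partial>Pi_meas k)"
    by simp
  also have "\<dots> = (\<Sum>m\<in>I. \<integral>t. (\<Sum>n\<in>I. (?s m * ?s n * Re (\<alpha> m * cnj (\<alpha> n))) * (CD k m t * CD k n t)) \<partial>Pi_meas k)"
    by (intro Bochner_Integration.integral_sum Bochner_Integration.integrable_sum
        integrable_mult_right integrable_CD_mult_CD)
  also have "\<dots> = (\<Sum>m\<in>I. \<Sum>n\<in>I. \<integral>t. (?s m * ?s n * Re (\<alpha> m * cnj (\<alpha> n))) * (CD k m t * CD k n t) \<partial>Pi_meas k)"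
    by (intro sum.cong refl Bochner_Integration.integral_sum
        integrable_mult_right integrable_CD_mult_CD)
  also have "\<dots> = (\<Sum>m\<in>I. \<Sum>n\<in>I. if m = n then ?s n * (cmod (\<alpha> n))\<^sup>2 else 0)"
  proof (intro sum.cong refl)
    fix m n
    have "?s n \<noteq> 0" using k by (simp add: sphere_card_def)
    moreover have "Re (\<alpha> n * cnj (\<alpha> n)) = (cmod (\<alpha> n))\<^sup>2"
      by (simp only: complex_norm_square[symmetric] Re_complex_of_real)
    ultimately show "(\<integral>t. (?s m * ?s n * Re (\<alpha> m * cnj (\<alpha> n))) * (CD k m t * CD k n t) \<partial>Pi_meas k) =
        (if m = n then ?s n * (cmod (\<alpha> n))\<^sup>2 else 0)"
      by (simp only: integral_mult_right_zero CD_orthogonal[OF k]) simp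
  qed
  also have "\<dots> = (\<Sum>m\<in>I. ?s m * (cmod (\<alpha> m))\<^sup>2)" using I by simp
  finally show ?thesis .
qed

lemma AE_summable_norm:
  fixes g :: "nat \<Rightarrow> 'a \<Rightarrow> 'b::{banach,second_countable_topology}"
  assumes g: "\<And>j. integrable M (g j)" and sm: "summable (\<lambda>j. \<integral>t. norm (g j t) \<partial>M)"
  shows "AE t in M. summable (\<lambda>j. norm (g j t))"
proof -
  have [measurable]: "g j \<in> borel_measurable M" for j using g by simp
  have "(\<integral>\<^sup>+ t. (\<Sum>j. ennreal (norm (g j t))) \<partial>M) = (\<Sum>j. \<integral>\<^sup>+ t. ennreal (norm (g j t)) \<partial>M)"
    by (rule nn_integral_suminf) simp
  also have "\<dots> = (\<Sum>j. ennreal (\<integral>t. norm (g j t) \<partial>M))"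
    using g by (simp add: nn_integral_eq_integral)
  also have "\<dots> \<noteq> \<infinity>"
    unfolding infinity_ennreal_def by (rule ennreal_suminf_neq_top[OF sm]) simp
  finally have "AE t in M. (\<Sum>j. ennreal (norm (g j t))) \<noteq> \<infinity>"
    by (intro nn_integral_PInf_AE) auto
  then show ?thesis
    by eventually_elim (auto intro: summable_suminf_not_top)
qed

text \<open>Passes from square norms to first-power norms by a \<le> (a^2 / e + e) / 2 and total
  mass 1.\<close>

lemma integral_norm_le_of_sq:
  fixes g :: "real \<Rightarrow> complex"
  assumes k: "k \<ge> 1" and g: "continuous_on UNIV g"
    and sq: "(\<integral>t. (cmod (g t))\<^sup>2 \<partial>Pi_meas k) \<le> e\<^sup>2" and e: "e > 0"
  shows "(\<integral>t. cmod (g t) \<partial>Pi_meas k) \<le> e"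
proof -
  interpret finite_measure "Pi_meas k" by (rule finite_measure_Pi)
  have i: "integrable (Pi_meas k) (\<lambda>t. (cmod (g t))\<^sup>2)" "integrable (Pi_meas k) (\<lambda>t. cmod (g t))"
    using g by (auto intro!: Pi_integrable_continuous continuous_intros)
  have "(\<integral>t. cmod (g t) \<partial>Pi_meas k) \<le> (\<integral>t. ((cmod (g t))\<^sup>2 / e + e) / 2 \<partial>Pi_meas k)"
  proof (rule integral_mono)
    fix t
    have "0 \<le> (cmod (g t) - e)\<^sup>2" by simp
    then show "cmod (g t) \<le> ((cmod (g t))\<^sup>2 / e + e) / 2"
      using e by (simp add: power2_diff field_simps power2_eq_square)
  qed (use i in auto)
  also have "\<dots> = ((\<integral>t. (cmod (g t))\<^sup>2 \<partial>Pi_meas k) / e + e) / 2"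
    using i measure_Pi_UNIV[OF k] by simp
  also have "\<dots> \<le> (e\<^sup>2 / e + e) / 2" using sq e by (intro divide_right_mono add_right_mono) auto
  also have "\<dots> = e" using e by (simp add: power2_eq_square)
  finally show ?thesis .
qed

text \<open>Riesz--Fischer for the orthogonal system \<open>CD k\<close>: along a subsequence whose increments are
  summable in the \<open>L\<^sup>1\<close> norm, the partial sums converge weakly against bounded functions.\<close>

lemma CD_sum_weak_limit:
  assumes k: "k \<ge> 1" and sm: "summable (\<lambda>n. sphere_card k n * (cmod (\<alpha> n))\<^sup>2)"
  obtains \<phi> r where "integrable (Pi_meas k) \<phi>" "filterlim r at_top sequentially"
    "\<forall>\<psi> C. \<psi> \<in> borel_measurable (Pi_meas k) \<longrightarrow> (AE t in Pi_meas k. cmod (\<psi> t) \<le> C) \<longrightarrow>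
      (\<lambda>j. \<integral>t. \<psi> t * CD_sum k \<alpha> {..<r j} t \<partial>Pi_meas k) \<longlonglongrightarrow> (\<integral>t. \<psi> t * \<phi> t \<partial>Pi_meas k)"
proof -
  let ?M = "Pi_meas k" and ?a = "\<lambda>n. sphere_card k n * (cmod (\<alpha> n))\<^sup>2"
  have a0: "?a n \<ge> 0" for n by (simp add: sphere_card_def)
  \<comment> \<open>The tolerance is a square so that the blocks below have first-power norm at most
    (1/2)^j, which is summable in j.\<close>
  have "\<exists>N. \<forall>m\<ge>N. \<forall>n. norm (sum ?a {m..<n}) < ((1/2)^j)\<^sup>2" for j
    using sm unfolding summable_Cauchy by simp
  then obtain N where N: "\<And>j m n. m \<ge> N j \<Longrightarrow> norm (sum ?a {m..<n}) < ((1/2)^j)\<^sup>2"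
    by metis
  \<comment> \<open>Summing all earlier \<open>N i\<close> makes \<open>r\<close> monotone and at
    least \<open>N j\<close>; adding \<open>j\<close> forces it to infinity even if the
    \<open>N i\<close> vanish.\<close>
  define r where "r j = (\<Sum>i\<le>j. N i) + j" for j
  have rN: "r j \<ge> N j" for j
    unfolding r_def using member_le_sum[of j "{..j}" N] by simp
  have rS: "r j \<le> r (Suc j)" for j by (simp add: r_def)
  have r: "filterlim r at_top sequentially"
    by (rule filterlim_at_top_mono[OF filterlim_ident]) (simp add: r_def)
  define g where "g j = CD_sum k \<alpha> {r j..<r (Suc j)}" for j
  define p where "p j = CD_sum k \<alpha> {..<r j}" for j
  have gp: "g j t = p (Suc j) t - p j t" for j t
  proof -
    have "sum F {..<r j} + sum F {r j..<r (Suc j)} = sum F {..<r (Suc j)}" for F :: "nat \<Rightarrow> complex"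
      using sum.atLeastLessThan_concat[OF _ rS[of j], of 0 F] by (simp add: lessThan_atLeast0)
    then show ?thesis unfolding g_def p_def CD_sum_def by (simp add: eq_diff_eq add.commute)
  qed
  have gc: "continuous_on UNIV (g j)" and pc: "continuous_on UNIV (p j)" for j
    unfolding g_def p_def by (rule continuous_on_CD_sum)+
  have gi: "integrable ?M (g j)" and pi: "integrable ?M (p j)" for j
    using Pi_integrable_continuous[OF gc] Pi_integrable_continuous[OF pc] .
  have gn: "(\<integral>t. cmod (g j t) \<partial>?M) \<le> (1/2)^j" for j
  proof (rule integral_norm_le_of_sq[OF k gc])
    show "(\<integral>t. (cmod (g j t))\<^sup>2 \<partial>?M) \<le> ((1/2)^j)\<^sup>2"
      using N[OF rN, of j "r (Suc j)"] a0 unfolding g_def integral_CD_sum_sq[OF k finite_atLeastLessThan]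
      by (simp add: sum_nonneg)
  qed simp
  have gsm: "summable (\<lambda>j. \<integral>t. cmod (g j t) \<partial>?M)"
    by (rule summable_comparison_test'[OF summable_geometric[of "1/2::real"]]) (use gn in auto)
  have AEs: "AE t in ?M. summable (\<lambda>j. cmod (g j t))"
    by (rule AE_summable_norm[OF gi gsm])
  \<comment> \<open>The blocks start at \<open>r 0\<close>, so the initial partial sum is added
    separately.\<close>
  define \<phi> where "\<phi> t = p 0 t + (\<Sum>j. g j t)" for t
  have sint: "integrable ?M (\<lambda>t. \<Sum>j. g j t)" by (rule integrable_suminf[OF gi AEs gsm])
  have \<phi>: "integrable ?M \<phi>" unfolding \<phi>_def using pi sint by simp
  show ?thesis
  proof (rule that[OF \<phi> r], intro allI impI)
    fix \<psi> C assume [measurable]: "\<psi> \<in> borel_measurable ?M" and C: "AE t in ?M. cmod (\<psi> t) \<le> C"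
    note im = integrable_bounded_mult[OF _ \<open>\<psi> \<in> borel_measurable ?M\<close> C]
    have pn: "AE t in ?M. cmod (\<psi> t * g j t) \<le> C * cmod (g j t)" for j
      using C by eventually_elim (simp add: norm_mult mult_right_mono)
    have 1: "AE t in ?M. summable (\<lambda>j. norm (\<psi> t * g j t))"
      using AEs by eventually_elim (simp add: norm_mult summable_mult)
    have 2: "summable (\<lambda>j. \<integral>t. norm (\<psi> t * g j t) \<partial>?M)"
    proof (rule summable_comparison_test'[OF summable_mult[OF gsm, of C]])
      fix j
      have "(\<integral>t. norm (\<psi> t * g j t) \<partial>?M) \<le> (\<integral>t. C * cmod (g j t) \<partial>?M)"
        using pn[of j] gi[of j] im[OF gi] by (intro integral_mono_AE) auto
      then show "norm (\<integral>t. norm (\<psi> t * g j t) \<partial>?M) \<le> C * (\<integral>t. cmod (g j t) \<partial>?M)" by simp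
    qed
    have "(\<lambda>j. \<integral>t. \<psi> t * g j t \<partial>?M) sums (\<integral>t. (\<Sum>j. \<psi> t * g j t) \<partial>?M)"
      by (rule sums_integral[OF im[OF gi] 1 2])
    also have "(\<integral>t. (\<Sum>j. \<psi> t * g j t) \<partial>?M) = (\<integral>t. \<psi> t * (\<Sum>j. g j t) \<partial>?M)"
    proof (rule integral_cong_AE)
      show "AE t in ?M. (\<Sum>j. \<psi> t * g j t) = \<psi> t * (\<Sum>j. g j t)"
        using AEs by eventually_elim (auto intro!: suminf_mult summable_norm_cancel)
    qed (use gi sint in \<open>auto intro!: borel_measurable_suminf borel_measurable_times\<close>)
    finally have "(\<lambda>J. \<Sum>j<J. \<integral>t. \<psi> t * g j t \<partial>?M) \<longlonglongrightarrow> (\<integral>t. \<psi> t * (\<Sum>j. g j t) \<partial>?M)"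
      unfolding sums_def .
    moreover have "(\<Sum>j<J. \<integral>t. \<psi> t * g j t \<partial>?M) = (\<integral>t. \<psi> t * p J t \<partial>?M) - (\<integral>t. \<psi> t * p 0 t \<partial>?M)" for J
    proof -
      have "(\<integral>t. \<psi> t * g j t \<partial>?M) = (\<integral>t. \<psi> t * p (Suc j) t \<partial>?M) - (\<integral>t. \<psi> t * p j t \<partial>?M)" for j
        unfolding gp right_diff_distrib using im[OF pi] by (intro Bochner_Integration.integral_diff)
      then show ?thesis using sum_lessThan_telescope[of "\<lambda>j. \<integral>t. \<psi> t * p j t \<partial>?M" J] by simp
    qed
    ultimately have "(\<lambda>J. (\<integral>t. \<psi> t * p J t \<partial>?M) - (\<integral>t. \<psi> t * p 0 t \<partial>?M) + (\<integral>t. \<psi> t * p 0 t \<partial>?M)) \<longlonglongrightarrow>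
        (\<integral>t. \<psi> t * (\<Sum>j. g j t) \<partial>?M) + (\<integral>t. \<psi> t * p 0 t \<partial>?M)"
      by (intro tendsto_add tendsto_const) simp
    moreover have "(\<integral>t. \<psi> t * (\<Sum>j. g j t) \<partial>?M) + (\<integral>t. \<psi> t * p 0 t \<partial>?M) = (\<integral>t. \<psi> t * \<phi> t \<partial>?M)"
      unfolding \<phi>_def distrib_left using im[OF pi] im[OF sint]
      by (simp add: Bochner_Integration.integral_add add.commute)
    ultimately show "(\<lambda>j. \<integral>t. \<psi> t * CD_sum k \<alpha> {..<r j} t \<partial>?M) \<longlonglongrightarrow> (\<integral>t. \<psi> t * \<phi> t \<partial>?M)"
      by (simp add: p_def)
  qed
qed

lemma fhat_CD_sum:
  assumes k: "k \<ge> 1"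
  shows "fhat k (CD_sum k \<alpha> {..<N}) m = (if m < N then \<alpha> m else 0)"
proof -
  have "fhat k (CD_sum k \<alpha> {..<N}) m =
      (\<integral>t. (\<Sum>n<N. \<alpha> n * of_real (sphere_card k n * (CD k m t * CD k n t))) \<partial>Pi_meas k)"
    unfolding fhat_def CD_sum_def
    by (intro Bochner_Integration.integral_cong refl) (simp add: sum_distrib_left mult_ac)
  also have "\<dots> = (\<Sum>n<N. \<integral>t. \<alpha> n * of_real (sphere_card k n * (CD k m t * CD k n t)) \<partial>Pi_meas k)"
    by (intro Bochner_Integration.integral_sum integrable_mult_right integrable_of_real integrable_CD_mult_CD)
  also have "\<dots> = (\<Sum>n<N. if n = m then \<alpha> n else 0)"
  proof (intro sum.cong refl)
    fix n
    have "sphere_card k n \<noteq> 0" using k by (simp add: sphere_card_def)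
    then show "(\<integral>t. \<alpha> n * of_real (sphere_card k n * (CD k m t * CD k n t)) \<partial>Pi_meas k) =
        (if n = m then \<alpha> n else 0)"
      by (simp only: integral_mult_right_zero integral_complex_of_real CD_orthogonal[OF k], cases "m = n") simp_all
  qed
  finally show ?thesis by simp
qed

text \<open>Testing with \<open>CD k m\<close>, which is bounded on the support, reads off a
  coefficient that is constant along the partial sums once \<open>r j > m\<close>.\<close>

lemma fhat_weak_limit:
  assumes k: "k \<ge> 1" and r: "filterlim r at_top sequentially"
    and lim: "\<forall>\<psi> C. \<psi> \<in> borel_measurable (Pi_meas k) \<longrightarrow> (AE t in Pi_meas k. cmod (\<psi> t) \<le> C) \<longrightarrow>
      (\<lambda>j. \<integral>t. \<psi> t * CD_sum k \<alpha> {..<r j} t \<partial>Pi_meas k) \<longlonglongrightarrow> (\<integral>t. \<psi> t * \<phi> t \<partial>Pi_meas k)"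
  shows "fhat k \<phi> m = \<alpha> m"
proof -
  obtain B where B: "AE t in Pi_meas k. cmod (of_real (CD k m t)) \<le> B" using CD_AE_bounded by blast
  have "(\<lambda>j. fhat k (CD_sum k \<alpha> {..<r j}) m) \<longlonglongrightarrow> fhat k \<phi> m"
    unfolding fhat_def by (rule lim[rule_format, OF _ B]) simp
  moreover have "\<forall>\<^sub>F j in sequentially. fhat k (CD_sum k \<alpha> {..<r j}) m = \<alpha> m"
    using eventually_compose_filterlim[OF eventually_gt_at_top[of m] r]
    by eventually_elim (simp add: fhat_CD_sum[OF k])
  then have "(\<lambda>j. fhat k (CD_sum k \<alpha> {..<r j}) m) \<longlonglongrightarrow> \<alpha> m" by (rule tendsto_eventually)
  ultimately show ?thesis by (rule LIMSEQ_unique)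
qed

section \<open>Surjectivity and multiplicativity\<close>

lemma B_Gamma_summable:
  assumes k: "k \<ge> 1" and K: "bounded_kernel (cayley_V k) K" and x: "x \<in> cayley_V k"
    and \<alpha>: "\<forall>x\<in>cayley_V k. \<forall>y\<in>cayley_V k. K x y = T_alpha k \<alpha> x y"
  shows "(\<lambda>z. (cmod (\<alpha> (tree_dist k x z)))\<^sup>2) summable_on cayley_V k"
proof -
  have "(\<lambda>z. (cmod (K z x))\<^sup>2) summable_on cayley_V k"
    by (rule bounded_kernel_column[OF K x])
  moreover have "K z x = \<alpha> (tree_dist k x z)" if "z \<in> cayley_V k" for z
    using \<alpha> that x tree_dist_sym[OF x that] by (simp add: T_alpha_def)
  ultimately show ?thesis by (subst summable_on_cong) auto
qed

lemma Tphi_surj: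
  assumes k: "k \<ge> 1" and K: "K \<in> B_Gamma k"
  shows "\<exists>\<phi>\<in>Linf k. \<forall>x\<in>cayley_V k. \<forall>y\<in>cayley_V k. Tphi k \<phi> x y = K x y"
proof -
  obtain \<alpha> where bK: "bounded_kernel (cayley_V k) K"
    and \<alpha>: "\<forall>x\<in>cayley_V k. \<forall>y\<in>cayley_V k. K x y = T_alpha k \<alpha> x y"
    using K by (auto simp: B_Gamma_def)
  have sm: "summable (\<lambda>n. sphere_card k n * (cmod (\<alpha> n))\<^sup>2)"
    by (rule summable_sphere_sq[OF k Nil_in_cayley_V B_Gamma_summable[OF k bK Nil_in_cayley_V \<alpha>]])
  obtain \<phi> r where \<phi>: "integrable (Pi_meas k) \<phi>" and r: "filterlim r at_top sequentially"
    and lim: "\<forall>\<psi> C. \<psi> \<in> borel_measurable (Pi_meas k) \<longrightarrow> (AE t in Pi_meas k. cmod (\<psi> t) \<le> C) \<longrightarrow>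
      (\<lambda>j. \<integral>t. \<psi> t * CD_sum k \<alpha> {..<r j} t \<partial>Pi_meas k) \<longlonglongrightarrow> (\<integral>t. \<psi> t * \<phi> t \<partial>Pi_meas k)"
    using CD_sum_weak_limit[OF k sm] by blast
  have hat: "fhat k \<phi> m = \<alpha> m" for m by (rule fhat_weak_limit[OF k r lim])
  obtain C where C: "\<And>F h. finite F \<Longrightarrow> F \<subseteq> cayley_V k \<Longrightarrow>
    cmod (\<Sum>y\<in>F. cnj (h y) * (\<Sum>x\<in>F. h x * K y x)) \<le> C * sq_sum F h"
    by (rule bounded_kernel_form[OF bK]) (rule that)
  \<comment> \<open>So far \<open>\<phi>\<close> is only integrable. Its coefficients agree with
    those of the kernel, so the operator bound now controls its integrals against squares of
    polynomials.\<close>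
  have "AE t in Pi_meas k. cmod (\<phi> t) \<le> 2 * C"
  proof (rule AE_bounded_if_poly_bounded[OF \<phi>])
    fix p :: "real \<Rightarrow> real" assume p: "real_polynomial_function p"
    obtain G h where G: "finite G" "G \<subseteq> cayley_V k"
      and Gi: "(\<integral>t. of_real ((p t)\<^sup>2) * \<phi> t \<partial>Pi_meas k) =
         (\<Sum>y\<in>G. cnj (h y) * (\<Sum>x\<in>G. h x * fhat k \<phi> (tree_dist k x y)))"
      and Gs: "(\<integral>t. (p t)\<^sup>2 \<partial>Pi_meas k) = sq_sum G h"
      using integral_poly_sq[OF k p \<phi>] by blast
    have "(\<Sum>y\<in>G. cnj (h y) * (\<Sum>x\<in>G. h x * fhat k \<phi> (tree_dist k x y))) =
        (\<Sum>y\<in>G. cnj (h y) * (\<Sum>x\<in>G. h x * K y x))"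
    proof (intro sum.cong refl arg_cong2[of _ _ _ _ "(*)"])
      fix x y assume "x \<in> G" "y \<in> G"
      then have xy: "x \<in> cayley_V k" "y \<in> cayley_V k" using G by auto
      then show "fhat k \<phi> (tree_dist k x y) = K y x"
        using \<alpha> tree_dist_sym[OF xy] by (simp add: hat T_alpha_def)
    qed
    then show "cmod (\<integral>t. of_real ((p t)\<^sup>2) * \<phi> t \<partial>Pi_meas k) \<le> C * (\<integral>t. (p t)\<^sup>2 \<partial>Pi_meas k)"
      unfolding Gi Gs using C[OF G] by simp
  qed
  then have "\<phi> \<in> Linf k" using \<phi> by (auto simp: Linf_def)
  moreover have "Tphi k \<phi> x y = K x y" if "x \<in> cayley_V k" "y \<in> cayley_V k" for x y
    using \<alpha> that by (simp add: Tphi_def T_alpha_def hat)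
  ultimately show ?thesis by blast
qed

text \<open>One sequence, the integrals of the Fourier partial sums of \<open>\<phi>\<close> against
  the bounded function \<open>CD * \<psi>\<close>, is evaluated in two ways. Its weak limit is a
  coefficient of the product, and the product formula rewrites its members as ball sums that
  converge to the composed kernel.\<close>

lemma Tphi_mult_eq_kernel_comp:
  assumes k: "k \<ge> 1" and \<phi>: "\<phi> \<in> Linf k" and \<psi>: "\<psi> \<in> Linf k"
    and x: "x \<in> cayley_V k" and y: "y \<in> cayley_V k"
  shows "Tphi k (\<lambda>t. \<phi> t * \<psi> t) x y = kernel_comp (cayley_V k) (Tphi k \<phi>) (Tphi k \<psi>) x y"
proof -
  let ?V = "cayley_V k" and ?M = "Pi_meas k" and ?P = "\<lambda>t. complex_of_real (CD k (tree_dist k x y) t)"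
  define \<alpha> \<beta> where "\<alpha> = fhat k \<phi>" and "\<beta> = fhat k \<psi>"
  have b: "bounded_kernel ?V (Tphi k \<phi>)" "bounded_kernel ?V (Tphi k \<psi>)"
    using Tphi_in_B_Gamma[OF k] \<phi> \<psi> by (auto simp: B_Gamma_def)
  have s\<alpha>: "(\<lambda>z. (cmod (\<alpha> (tree_dist k x z)))\<^sup>2) summable_on ?V"
    by (rule B_Gamma_summable[OF k b(1) x]) (simp add: Tphi_def \<alpha>_def)
  have s\<beta>: "(\<lambda>z. (cmod (\<beta> (tree_dist k z y)))\<^sup>2) summable_on ?V"
    using bounded_kernel_column[OF b(2) y] by (simp add: Tphi_def T_alpha_def \<beta>_def)
  obtain \<omega> r where \<omega>: "integrable ?M \<omega>" and r: "filterlim r at_top sequentially"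
    and lim: "\<forall>\<psi> C. \<psi> \<in> borel_measurable ?M \<longrightarrow> (AE t in ?M. cmod (\<psi> t) \<le> C) \<longrightarrow>
      (\<lambda>j. \<integral>t. \<psi> t * CD_sum k \<alpha> {..<r j} t \<partial>?M) \<longlonglongrightarrow> (\<integral>t. \<psi> t * \<omega> t \<partial>?M)"
    using CD_sum_weak_limit[OF k summable_sphere_sq[OF k x s\<alpha>]] by blast
  have "fhat k \<omega> m = fhat k \<phi> m" for m
    using fhat_weak_limit[OF k r lim] by (simp add: \<alpha>_def)
  \<comment> \<open>The weak limit \<open>\<omega>\<close> comes without any relation to
    \<open>\<phi>\<close>; uniqueness of coefficients identifies the two.\<close>
  then have AEeq: "AE t in ?M. \<omega> t = \<phi> t"
    by (intro fhat_eq_imp_AE_eq[OF k \<omega> Linf_integrable[OF \<phi>]])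
  have [measurable]: "\<omega> \<in> borel_measurable ?M" "\<phi> \<in> borel_measurable ?M" "\<psi> \<in> borel_measurable ?M"
    using \<omega> \<phi> \<psi> by (auto simp: Linf_def)
  obtain B C where B: "AE t in ?M. cmod (?P t) \<le> B" and C: "AE t in ?M. cmod (\<psi> t) \<le> C"
    using CD_AE_bounded[of k "tree_dist k x y"] \<psi> by (auto simp: Linf_def)
  have bd: "AE t in ?M. cmod (?P t * \<psi> t) \<le> B * C"
    using B C by eventually_elim
      (simp only: norm_mult, rule mult_mono, auto intro: order_trans[OF norm_ge_zero])
  have "(\<lambda>j. \<integral>t. ?P t * \<psi> t * CD_sum k \<alpha> {..<r j} t \<partial>?M) \<longlonglongrightarrow> (\<integral>t. ?P t * \<psi> t * \<omega> t \<partial>?M)"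
    by (rule lim[rule_format, OF _ bd]) simp
  also have "(\<integral>t. ?P t * \<psi> t * \<omega> t \<partial>?M) = fhat k (\<lambda>t. \<phi> t * \<psi> t) (tree_dist k x y)"
    unfolding fhat_def using AEeq by (intro integral_cong_AE) (auto simp: mult_ac)
  also have "(\<lambda>j. \<integral>t. ?P t * \<psi> t * CD_sum k \<alpha> {..<r j} t \<partial>?M) =
      (\<lambda>j. \<Sum>z\<in>ball_at k x (r j). \<alpha> (tree_dist k x z) * \<beta> (tree_dist k z y))"
  proof
    fix j
    note i\<psi> = integrable_CD_mult[OF Linf_integrable[OF \<psi>]]
    \<comment> \<open>The product formula, read from right to left, replaces each term of the
      partial sum by a sum over the sphere around \<open>x\<close>.\<close>
    have "?P t * \<psi> t * CD_sum k \<alpha> {..<r j} t =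
        (\<Sum>z\<in>ball_at k x (r j). \<alpha> (tree_dist k x z) * (of_real (CD k (tree_dist k z y) t) * \<psi> t))" for t
    proof -
      have "?P t * \<psi> t * CD_sum k \<alpha> {..<r j} t =
          (\<Sum>n<r j. \<alpha> n * (of_real (sphere_card k n * CD k n t * CD k (tree_dist k x y) t) * \<psi> t))"
        by (simp add: CD_sum_def sum_distrib_left mult_ac)
      also have "\<dots> = (\<Sum>n<r j. \<Sum>z\<in>sphere_at k x n.
          \<alpha> (tree_dist k x z) * (of_real (CD k (tree_dist k z y) t) * \<psi> t))"
      proof (intro sum.cong refl)
        fix n
        show "\<alpha> n * (of_real (sphere_card k n * CD k n t * CD k (tree_dist k x y) t) * \<psi> t) =
          (\<Sum>z\<in>sphere_at k x n. \<alpha> (tree_dist k x z) * (of_real (CD k (tree_dist k z y) t) * \<psi> t))"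
          by (simp add: sphere_at_def sum_distrib_left sum_distrib_right
              flip: sum_sphere_CD[OF k x y])
      qed
      finally show ?thesis by (simp only: sum_ball_at[OF x])
    qed
    then have "(\<integral>t. ?P t * \<psi> t * CD_sum k \<alpha> {..<r j} t \<partial>?M) =
       (\<integral>t. (\<Sum>z\<in>ball_at k x (r j). \<alpha> (tree_dist k x z) * (of_real (CD k (tree_dist k z y) t) * \<psi> t)) \<partial>?M)"
      by simp
    also have "\<dots> = (\<Sum>z\<in>ball_at k x (r j). \<alpha> (tree_dist k x z) * \<beta> (tree_dist k z y))"
      using i\<psi> by (simp add: Bochner_Integration.integral_sum integrable_mult_right \<beta>_def fhat_def)
    finally show "(\<integral>t. ?P t * \<psi> t * CD_sum k \<alpha> {..<r j} t \<partial>?M) =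
       (\<Sum>z\<in>ball_at k x (r j). \<alpha> (tree_dist k x z) * \<beta> (tree_dist k z y))" .
  qed
  finally have lim1: "(\<lambda>j. \<Sum>z\<in>ball_at k x (r j). \<alpha> (tree_dist k x z) * \<beta> (tree_dist k z y))
     \<longlonglongrightarrow> fhat k (\<lambda>t. \<phi> t * \<psi> t) (tree_dist k x y)" .
  \<comment> \<open>The row of one kernel and the column of the other are square summable, so the
    product sums unconditionally and balls may be used to compute it.\<close>
  have "(\<lambda>j. sum (\<lambda>z. \<alpha> (tree_dist k x z) * \<beta> (tree_dist k z y)) (ball_at k x (r j)))
     \<longlonglongrightarrow> (\<Sum>\<^sub>\<infinity>z\<in>?V. \<alpha> (tree_dist k x z) * \<beta> (tree_dist k z y))"
    by (rule filterlim_compose[OF infsum_tendsto[OF summable_on_mult_l2[OF s\<alpha> s\<beta>]]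
          filterlim_compose[OF filterlim_ball_at[OF x] r]])
  from LIMSEQ_unique[OF lim1 this] show ?thesis
    by (simp add: Tphi_def T_alpha_def kernel_comp_def \<alpha>_def \<beta>_def)
qed

text \<open>Every distance occurs, so equal kernels have equal coefficients of every index;
  injectivity rests on this.\<close>

lemma tree_dist_surj:
  assumes k: "k \<ge> 1" shows "\<exists>z\<in>cayley_V k. tree_dist k [] z = n"
proof -
  have "sphere_card k n > 0" using k by (simp add: sphere_card_def)
  then have "sphere_at k [] n \<noteq> {}" using card_sphere_at[OF k Nil_in_cayley_V, of n] by auto
  then show ?thesis by (auto simp: sphere_at_def)
qed

theorem theorem1p2:
  fixes k :: nat
  assumes "k \<ge> 1"
  shows "(\<forall>\<phi>\<in>Linf k. Tphi k \<phi> \<in> B_Gamma k)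
    \<and> (\<forall>\<phi>\<in>Linf k. \<forall>\<psi>\<in>Linf k. \<forall>c::complex. \<forall>x\<in>cayley_V k. \<forall>y\<in>cayley_V k.
          Tphi k (\<lambda>t. \<phi> t + \<psi> t) x y = Tphi k \<phi> x y + Tphi k \<psi> x y
        \<and> Tphi k (\<lambda>t. c * \<phi> t) x y = c * Tphi k \<phi> x y
        \<and> Tphi k (\<lambda>t. \<phi> t * \<psi> t) x y = kernel_comp (cayley_V k) (Tphi k \<phi>) (Tphi k \<psi>) x y
        \<and> Tphi k (\<lambda>t. cnj (\<phi> t)) x y = kernel_adj (Tphi k \<phi>) x y)
    \<and> (\<forall>\<phi>\<in>Linf k. \<forall>\<psi>\<in>Linf k.
          (\<forall>x\<in>cayley_V k. \<forall>y\<in>cayley_V k. Tphi k \<phi> x y = Tphi k \<psi> x y)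
          \<longleftrightarrow> (AE t in Pi_meas k. \<phi> t = \<psi> t))
    \<and> (\<forall>K\<in>B_Gamma k. \<exists>\<phi>\<in>Linf k. \<forall>x\<in>cayley_V k. \<forall>y\<in>cayley_V k. Tphi k \<phi> x y = K x y)"
proof (intro conjI ballI allI)
  fix \<phi> \<psi> :: "real \<Rightarrow> complex" and c x y
  assume \<phi>: "\<phi> \<in> Linf k" and \<psi>: "\<psi> \<in> Linf k" and x: "x \<in> cayley_V k" and y: "y \<in> cayley_V k"
  show "Tphi k (\<lambda>t. \<phi> t + \<psi> t) x y = Tphi k \<phi> x y + Tphi k \<psi> x y"
    using \<phi> \<psi> by (simp add: Tphi_def T_alpha_def fhat_add Linf_integrable)
  show "Tphi k (\<lambda>t. c * \<phi> t) x y = c * Tphi k \<phi> x y"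
    by (simp add: Tphi_def T_alpha_def fhat_scale)
  show "Tphi k (\<lambda>t. \<phi> t * \<psi> t) x y = kernel_comp (cayley_V k) (Tphi k \<phi>) (Tphi k \<psi>) x y"
    by (rule Tphi_mult_eq_kernel_comp[OF assms \<phi> \<psi> x y])
  show "Tphi k (\<lambda>t. cnj (\<phi> t)) x y = kernel_adj (Tphi k \<phi>) x y"
    using tree_dist_sym[OF x y] by (simp add: Tphi_def T_alpha_def kernel_adj_def fhat_cnj)
next
  fix \<phi> \<psi> assume \<phi>: "\<phi> \<in> Linf k" and \<psi>: "\<psi> \<in> Linf k"
  show "(\<forall>x\<in>cayley_V k. \<forall>y\<in>cayley_V k. Tphi k \<phi> x y = Tphi k \<psi> x y)
      \<longleftrightarrow> (AE t in Pi_meas k. \<phi> t = \<psi> t)"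
  proof
    assume eq: "\<forall>x\<in>cayley_V k. \<forall>y\<in>cayley_V k. Tphi k \<phi> x y = Tphi k \<psi> x y"
    have "fhat k \<phi> n = fhat k \<psi> n" for n
    proof -
      obtain z where "z \<in> cayley_V k" "tree_dist k [] z = n" using tree_dist_surj[OF assms] by blast
      then show ?thesis using eq Nil_in_cayley_V by (auto simp: Tphi_def T_alpha_def)
    qed
    then show "AE t in Pi_meas k. \<phi> t = \<psi> t"
      using \<phi> \<psi> by (intro fhat_eq_imp_AE_eq[OF assms] Linf_integrable)
  next
    assume "AE t in Pi_meas k. \<phi> t = \<psi> t"
    then have "fhat k \<phi> n = fhat k \<psi> n" for n
      using \<phi> \<psi> by (intro fhat_cong_AE) (auto simp: Linf_def)
    then show "\<forall>x\<in>cayley_V k. \<forall>y\<in>cayley_V k. Tphi k \<phi> x y = Tphi k \<psi> x y"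
      by (simp add: Tphi_def T_alpha_def)
  qed
qed (use assms Tphi_in_B_Gamma Tphi_surj in auto)

end
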